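(* Let $n\in\mathbb N_0$, let $p,r,t,u\in\{1,2,3,4\}$ be distinct and fixed, let $q\in\mathbb C^*$ with $|q|\neq1$, let $\mathbf a=(a_1,a_2,a_3,a_4)$ with $a_k\in\mathbb C^*$, and let $x=\cos\theta\in[-1,1]$. Then the Askey--Wilson polynomials $p_n(x;\mathbf a|q)$, defined by the first line below, have the following terminating basic hypergeometric representations (each holding for parameters such that no denominator in it, or in the first line, vanishes): $$p_n(x;\mathbf a|q):=a_p^{-n}\left(\{a_{ps}\}_{s\ne p};q\right)_n\,{}_4\phi_3\left(q^{-n},q^{n-1}a_{1234},a_pe^{\pm i\theta};\,\{a_{ps}\}_{s\neq p};\,q,q\right)$$ $$=q^{-\binom n2}(-a_p)^{-n}\frac{\left(\frac{a_{1234}}q;q\right)_{2n}\left(a_pe^{\pm i\theta};q\right)_n}{\left(\frac{a_{1234}}q;q\right)_n}\,{}_4\phi_3\left(q^{-n},\left\{\frac{q^{1-n}}{a_{ps}}\right\}_{s\ne p};\,\frac{q^{2-2n}}{a_{1234}},\frac{q^{1-n}e^{\pm i\theta}}{a_p};\,q,q\right)$$ $$=e^{in\theta}\left(a_{pr},a_te^{-i\theta},a_ue^{-i\theta};q\right)_n\,{}_4\phi_3\left(q^{-n},a_pe^{i\theta},a_re^{i\theta},\frac{q^{1-n}}{a_{tu}};\,a_{pr},\frac{q^{1-n}e^{i\theta}}{a_t},\frac{q^{1-n}e^{i\theta}}{a_u};\,q,q\right)$$ $$=e^{in\theta}\frac{\left(\frac{a_{1234}}q;q\right)_{2n}\left(\{a_se^{-i\theta}\}_{s\ne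 p},\frac{a_{1234}e^{-i\theta}}{qa_p};q\right)_n}{\left(\frac{a_{1234}}q;q\right)_n\left(\frac{a_{1234}e^{-i\theta}}{qa_p};q\right)_{2n}}\,{}_8W_7\left(\frac{q^{1-2n}a_pe^{i\theta}}{a_{1234}};q^{-n},\left\{\frac{q^{1-n}a_{ps}}{a_{1234}}\right\}_{s\ne p},a_pe^{i\theta};q,\frac{qe^{i\theta}}{a_p}\right)$$ $$=e^{in\theta}\frac{\left(a_pe^{-i\theta},\left\{\frac{a_{1234}}{a_{ps}}\right\}_{s\ne p};q\right)_n}{\left(\frac{a_{1234}e^{i\theta}}{a_p};q\right)_n}\,{}_8W_7\left(\frac{a_{1234}e^{i\theta}}{qa_p};q^{-n},\{a_se^{i\theta}\}_{s\ne p},q^{n-1}a_{1234};q,\frac{qe^{-i\theta}}{a_p}\right)$$ $$=a_p^{-n}\frac{\left(a_{pt},a_{pu},a_re^{\pm i\theta};q\right)_n}{\left(\frac{a_r}{a_p};q\right)_n}\,{}_8W_7\left(\frac{q^{-n}a_p}{a_r};q^{-n},\frac{q^{1-n}}{a_{rt}},\frac{q^{1-n}}{a_{ru}},a_pe^{\pm i\theta};q,q^na_{tu}\right)$$ $$=e^{in\theta}\frac{\left(\{a_se^{-i\theta}\};q\right)_n}{\left(e^{-2i\theta};q\right)_n}\,{}_8W_7\left(q^{-n}e^{2i\theta};q^{-n},\{a_se^{i\theta}\};q,\frac{q^{2-n}}{a_{1234}}\right).$$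
   Context: $\mathbb N_0=\{0,1,2,\ldots\}$, $\mathbb C^*=\mathbb C\setminus\{0\}$. Products of parameters: $a_{jk}=a_ja_k$, $a_{1234}=a_1a_2a_3a_4$. Lists: $ce^{\pm i\theta}$ stands for the two entries $ce^{i\theta},ce^{-i\theta}$; $\{f_s\}_{s\ne p}$ stands for the three entries $f_s$, $s\in\{1,2,3,4\}\setminus\{p\}$; $\{f_s\}$ stands for the four entries $f_s$, $s\in\{1,2,3,4\}$. The $q$-Pochhammer symbol is $(a;q)_n=(1-a)(1-aq)\cdots(1-aq^{n-1})$ (empty product equal to $1$), and $(a_1,\ldots,a_k;q)_n=(a_1;q)_n\cdots(a_k;q)_n$. The terminating series are $${}_4\phi_3(q^{-n},\alpha,\beta,\gamma;\,\delta,\epsilon,\zeta;\,q,z)=\sum_{k=0}^n\frac{(q^{-n},\alpha,\beta,\gamma;q)_k}{(q,\delta,\epsilon,\zeta;q)_k}z^k,$$ $${}_8W_7(b;q^{-n},c,d,e,f;q,z)=\sum_{k=0}^n\frac{\left(b,q\sqrt b,-q\sqrt b,q^{-n},c,d,e,f;q\right)_k}{\left(q,\sqrt b,-\sqrt b,q^{n+1}b,\frac{qb}c,\frac{qb}d,\frac{qb}e,\frac{qb}f;q\right)_k}z^k,$$ where $\sqrt b$ is either square root of $b$. (In these two definitions $e$ is a parameter, while in the claim $e^{i\theta}$ is the exponential.) Standing convention: denominator parameters of a terminating series avoid $\{q^{-k}:0\le k\le n-1\}$, so that no denominator vanishes. *)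

theory Defs
  imports Complex_Main
begin

definition qpoch :: "complex \<Rightarrow> complex \<Rightarrow> nat \<Rightarrow> complex" where
  "qpoch a q n = (\<Prod>j<n. 1 - a * q ^ j)"

definition qpochs :: "complex list \<Rightarrow> complex \<Rightarrow> nat \<Rightarrow> complex" where
  "qpochs as q n = prod_list (map (\<lambda>a. qpoch a q n) as)"

text \<open>
  The lists \<open>{f_s}\<close> (four entries) and \<open>{f_s}\<close> with \<open>s \<noteq> p\<close> (three entries). Their order is
  immaterial, since they are only used as parameter lists of \<^const>\<open>qpochs\<close> and of the series below.
\<close>

definition entries :: "(nat \<Rightarrow> complex) \<Rightarrow> complex list" where
  "entries f = map f [1, 2, 3, 4]"

definition entries_except :: "nat \<Rightarrow> (nat \<Rightarrow> complex) \<Rightarrow> complex list" where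
  "entries_except p f = map f (filter (\<lambda>s. s \<noteq> p) [1, 2, 3, 4])"

text \<open>
  The terminating series with numerator parameters \<open>q^{-n}, as\<close> and denominator parameters \<open>bs\<close>
  (in addition to \<open>q\<close>). It is the usual basic hypergeometric series when \<open>as\<close> and \<open>bs\<close> have the
  same length; length three gives the \<open>4phi3\<close>.
\<close>

definition qhyp :: "nat \<Rightarrow> complex \<Rightarrow> complex list \<Rightarrow> complex list \<Rightarrow> complex \<Rightarrow> complex" where
  "qhyp n q as bs z =
     (\<Sum>k\<le>n. qpochs (q powi (- int n) # as) q k / qpochs (q # bs) q k * z ^ k)"

text \<open>
  The very-well-poised series \<open>8W7(b; q^{-n}, cs; q, z)\<close> for four parameters \<open>cs\<close>. The argument \<open>s\<close>
  is the chosen square root of \<open>b\<close>; every use below is accompanied by \<open>s^2 = b\<close>.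
\<close>

definition W_upper :: "complex \<Rightarrow> complex \<Rightarrow> complex \<Rightarrow> complex list \<Rightarrow> complex list" where
  "W_upper q b s cs = [b, q * s, - (q * s)] @ cs"

definition W_lower :: "nat \<Rightarrow> complex \<Rightarrow> complex \<Rightarrow> complex \<Rightarrow> complex list \<Rightarrow> complex list" where
  "W_lower n q b s cs = [s, - s, q ^ (n + 1) * b] @ map (\<lambda>c. q * b / c) cs"

definition W87 :: "nat \<Rightarrow> complex \<Rightarrow> complex \<Rightarrow> complex \<Rightarrow> complex list \<Rightarrow> complex \<Rightarrow> complex" where
  "W87 n q b s cs z = qhyp n q (W_upper q b s cs) (W_lower n q b s cs) z"

text \<open>
  No denominator of a terminating series with denominator parameters \<open>bs\<close> vanishes. The remaining
  denominator parameter \<open>q\<close> is harmless, as \<open>q\<close> is not a root of unity.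
\<close>

definition admissible :: "nat \<Rightarrow> complex \<Rightarrow> complex list \<Rightarrow> bool" where
  "admissible n q bs \<longleftrightarrow> (\<forall>b\<in>set bs. \<forall>k<n. b \<noteq> q powi (- int k))"

text \<open>
  The Askey--Wilson polynomial \<open>p_n(x; a | q)\<close> for real \<open>x\<close> in \<open>[-1, 1]\<close>, with distinguished index
  \<open>p\<close>. It is given by its \<open>4phi3\<close> expression at \<open>x = cos \<theta>\<close>; the choice \<open>\<theta> = arccos x\<close> is
  immaterial because the expression is invariant under \<open>\<theta> \<mapsto> -\<theta>\<close>.
\<close>

definition askey_wilson ::
    "nat \<Rightarrow> nat \<Rightarrow> real \<Rightarrow> (nat \<Rightarrow> complex) \<Rightarrow> complex \<Rightarrow> complex" where
  "askey_wilson p n x a q =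
     (let \<theta> = arccos x in
      a p powi (- int n) * qpochs (entries_except p (\<lambda>s. a p * a s)) q n
      * qhyp n q
          [q powi (int n - 1) * (a 1 * a 2 * a 3 * a 4), a p * cis \<theta>, a p * cis (- \<theta>)]
          (entries_except p (\<lambda>s. a p * a s)) q)"

end

theory Submission
  imports Defs "HOL-Library.Multiset"
begin

text \<open>
  All seven expressions are, up to explicit factors, values of one polynomial: the terminating
  balanced series \<open>4phi3(q^-n, c, d, h; x, y, q^(1-n)/g; q, q)\<close> multiplied by \<open>(x, y, g; q)_n\<close>,
  called \<open>cleared_phi\<close> below. Working with this polynomial instead of the quotient
  means that every transformation of balanced series holds for all non-zero parameters, and no passage
  to a limit is needed for exceptional ones; one divides only at the very end by quantities that are
  non-zero by the stated conditions.

  Three facts about \<open>cleared_phi\<close> are used. Sears' transformation (\<open>sears\<close>) is an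
  identity without prefactor in this normalisation; it follows by applying the \<open>q\<close>-Pfaff--Saalschuetz
  sum (\<open>q_saalschuetz\<close>) twice. Reversing the order of summation (\<open>cleared_phi_reverse\<close>) and, as a
  consequence, changing the distinguished denominator parameter (\<open>cleared_phi_exchange\<close>) are
  elementary. Finally, Watson's transformation (\<open>watson\<close>) identifies a terminating very-well-poised
  \<open>8W7\<close> with a \<open>cleared_phi\<close>; it comes from the Pfaff--Saalschuetz sum and the very-well-poised
  \<open>6phi5\<close> sum (\<open>very_well_poised_6phi5_sum\<close>). Both sums are proved by induction on the length, from the
  two Pascal-type recurrences of the Gaussian binomials.

  Write \<open>a, b, c, d\<close> for the four parameters with \<open>a\<close> distinguished, \<open>E = e^(i\<theta>)\<close>, and
  \<open>v = q^(1-n)\<close>. The polynomial is a multiple of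
  \<open>cleared_phi(q^(n-1) a b c d, a E, a/E; a b, a c; v/(a d))\<close>, and by Sears of
  \<open>cleared_phi(a E, b E, v/(c d); a b, v E/d; c/E)\<close>. Reversing the first form gives the second
  \<open>4phi3\<close>, and the second form is the third \<open>4phi3\<close>. Applied to each of the four \<open>8W7\<close>, with its
  parameters paired suitably, Watson's transformation produces one of these two forms, possibly
  after a reversal or an exchange and with \<open>E\<close> replaced by \<open>1/E\<close>.
\<close>

section \<open>Shifted factorials\<close>

lemma qpoch_0 [simp]: "qpoch a q 0 = 1"
  by (simp add: qpoch_def)

lemma qpoch_Suc: "qpoch a q (Suc n) = qpoch a q n * (1 - a * q ^ n)"
  by (simp add: qpoch_def)

lemma qpoch_add: "qpoch a q (m + n) = qpoch a q m * qpoch (a * q ^ m) q n"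
  by (induction n) (simp_all add: qpoch_Suc power_add mult_ac)

lemma qpoch_Suc_shift: "qpoch a q (Suc n) = (1 - a) * qpoch (a * q) q n"
  using qpoch_add[of a q 1 n] by (simp add: qpoch_Suc)

lemma qpoch_eq_0_iff: "qpoch a q n = 0 \<longleftrightarrow> (\<exists>i<n. a * q ^ i = 1)"
  by (auto simp: qpoch_def)

text \<open>
  The factor that appears when the \<open>n\<close> factors of a \<open>q\<close>-shifted factorial are written in terms of
  the reciprocal argument. All powers of the form \<open>q^(n choose 2)\<close> below are handled through
  it, by its additive law and the value of its square.
\<close>
definition qsign :: "complex \<Rightarrow> nat \<Rightarrow> complex" where
  "qsign q n = (- 1) ^ n * q ^ (n choose 2)"

lemma qsign_0 [simp]: "qsign q 0 = 1"
  by (simp add: qsign_def numeral_2_eq_2)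

lemma qsign_Suc: "qsign q (Suc n) = - (qsign q n * q ^ n)"
  by (simp add: qsign_def numeral_2_eq_2 power_add mult_ac)

lemma qsign_add: "qsign q (m + n) = qsign q m * qsign q n * q ^ (m * n)"
  by (induction n) (simp_all add: qsign_Suc power_add mult_ac)

lemma qsign_square: "qsign q n * qsign q n * q ^ n = q ^ (n * n)"
proof (induction n)
  case (Suc n)
  have "qsign q (Suc n) * qsign q (Suc n) * q ^ Suc n
      = (qsign q n * qsign q n * q ^ n) * (q ^ n * q ^ n * q)"
    by (simp add: qsign_Suc power_add mult_ac)
  also have "\<dots> = q ^ (Suc n * Suc n)"
    unfolding Suc.IH by (simp add: power_add mult_ac)
  finally show ?case .
qed simp

lemma qsign_nonzero: "q \<noteq> 0 \<Longrightarrow> qsign q n \<noteq> 0"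
  by (simp add: qsign_def)

text \<open>
  Each factor satisfies \<open>1 - y = -y (1 - 1/y)\<close>; the reciprocals \<open>1/(x q^i)\<close> again form a geometric
  progression with ratio \<open>q\<close> once they are read from \<open>i = n - 1\<close> down to \<open>i = 0\<close>.
\<close>
lemma qpoch_flip:
  assumes "q \<noteq> 0" "x \<noteq> 0"
  shows "qpoch x q n = qsign q n * x ^ n * qpoch (q / (q ^ n * x)) q n"
proof (induction n)
  case (Suc n)
  have "qpoch (q / (q ^ Suc n * x)) q (Suc n)
      = (1 - 1 / (q ^ n * x)) * qpoch (q / (q ^ n * x)) q n"
    using assms by (simp add: qpoch_Suc_shift)
  moreover have "1 - x * q ^ n = - (q ^ n * x) * (1 - 1 / (q ^ n * x))"
    using assms by (simp add: field_simps)
  ultimately show ?case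
    by (simp add: qpoch_Suc qsign_Suc Suc.IH mult_ac)
qed simp

lemma qpoch_shift_flip:
  assumes "q \<noteq> 0" "x \<noteq> 0"
  shows "qpoch (x * q ^ m) q j
       = qsign q j * q ^ (m * j) * x ^ j * qpoch (q / (q ^ (j + m) * x)) q j"
proof -
  have "(x * q ^ m) ^ j = q ^ (m * j) * x ^ j"
    by (simp add: power_mult_distrib flip: power_mult)
  moreover have "q ^ j * (x * q ^ m) = q ^ (j + m) * x"
    by (simp add: power_add mult_ac)
  ultimately show ?thesis
    using qpoch_flip[of q "x * q ^ m" j] assms by (simp only: mult_eq_0_iff power_not_zero simp_thms mult_ac)
qed

lemma sum_triangle_shift:
  fixes f :: "nat \<Rightarrow> nat \<Rightarrow> complex"
  shows "(\<Sum>k\<le>n. \<Sum>j\<le>k. f k j) = (\<Sum>j\<le>n. \<Sum>m\<le>n - j. f (j + m) j)"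
proof (induction n)
  case (Suc n)
  have "(\<Sum>m\<le>Suc n - j. f (j + m) j) = (\<Sum>m\<le>n - j. f (j + m) j) + f (Suc n) j"
    if "j \<le> n" for j
    using that by (simp add: Suc_diff_le)
  then show ?case
    using Suc.IH by (simp add: sum.distrib)
qed simp

section \<open>Gaussian binomials and the Pfaff--Saalschuetz sum\<close>

text \<open>
  A number \<open>q \<noteq> 0\<close> with \<open>|q| \<noteq> 1\<close> satisfies these conditions, which make \<open>(q;q)_n\<close> invertible.
\<close>
locale not_root_of_unity =
  fixes q :: complex
  assumes q_nonzero: "q \<noteq> 0" and q_power_neq_1: "i > 0 \<Longrightarrow> q ^ i \<noteq> 1"
begin

abbreviation poch :: "complex \<Rightarrow> nat \<Rightarrow> complex" where
  "poch a n \<equiv> qpoch a q n"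

lemma poch_q_nonzero: "poch q n \<noteq> 0"
  using q_power_neq_1[of "Suc i" for i] by (auto simp: qpoch_eq_0_iff)

text \<open>
  The value \<open>0\<close> for \<open>k > n\<close> makes the recurrences below true up to \<open>k = n + 1\<close>, so that no boundary
  terms have to be separated in the telescoping arguments.
\<close>
definition qbinom :: "nat \<Rightarrow> nat \<Rightarrow> complex" where
  "qbinom n k = (if k \<le> n then poch q n / (poch q k * poch q (n - k)) else 0)"

lemma qbinom_0 [simp]: "qbinom n 0 = 1" and qbinom_self [simp]: "qbinom n n = 1"
  by (simp_all add: qbinom_def poch_q_nonzero)

lemma qbinom_symmetric: "k \<le> n \<Longrightarrow> qbinom n (n - k) = qbinom n k"
  by (simp add: qbinom_def)

lemma qbinom_mult: "j + m \<le> n \<Longrightarrow> qbinom n (j + m) * qbinom (j + m) j = qbinom n j * qbinom (n - j) m"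
  using poch_q_nonzero by (simp add: qbinom_def field_simps)

text \<open>
  The entry \<open>[n, k - 1]\<close>, with \<open>0\<close> in place of the missing entry \<open>k - 1 = -1\<close>.
\<close>
definition qbinom_left :: "nat \<Rightarrow> nat \<Rightarrow> complex" where
  "qbinom_left n k = (case k of 0 \<Rightarrow> 0 | Suc j \<Rightarrow> qbinom n j)"

lemma qbinom_left_simps [simp]:
  "qbinom_left n 0 = 0" "qbinom_left n (Suc k) = qbinom n k"
  by (simp_all add: qbinom_left_def)

text \<open>
  The three entries in one step of Pascal's rule are multiples of a common quotient, with factors
  \<open>1 - q^i\<close>. The absorption rule and Pascal's rule then become identities between these factors.
\<close>
lemma qbinom_neighbours:
  fixes j m
  defines "n \<equiv> Suc (j + m)"
  obtains X where
    "qbinom (Suc n) (Suc j) = X * (1 - q ^ Suc n)"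
    "qbinom n (Suc j) = X * (1 - q ^ Suc m)"
    "qbinom n j = X * (1 - q ^ Suc j)"
proof
  have nz: "1 - q * q ^ i \<noteq> 0" for i
    using q_power_neq_1[of "Suc i"] by auto
  obtain M J where M: "M = 1 - q * q ^ m" and J: "J = 1 - q * q ^ j"
    by blast
  have [simp]: "M \<noteq> 0" "J \<noteq> 0" "poch q i \<noteq> 0" for i
    using nz poch_q_nonzero by (auto simp: M J)
  have pm: "poch q (Suc m) = poch q m * M" and pj: "poch q (Suc j) = poch q j * J"
    by (simp_all add: qpoch_Suc M J)
  let ?X = "poch q n / (poch q (Suc m) * poch q (Suc j))"
  show "qbinom (Suc n) (Suc j) = ?X * (1 - q ^ Suc n)"
    by (simp add: qbinom_def n_def Suc_diff_le qpoch_Suc[of q q "Suc (j + m)"] mult_ac)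
  show "qbinom n (Suc j) = ?X * (1 - q ^ Suc m)"
    by (simp add: qbinom_def n_def pm pj flip: M J)
  show "qbinom n j = ?X * (1 - q ^ Suc j)"
    by (simp add: qbinom_def n_def Suc_diff_le pm pj flip: M J)
qed

lemma qbinom_absorb:
  assumes "k \<le> Suc n"
  shows "(1 - q ^ k) * qbinom n k = (1 - q ^ (Suc n - k)) * qbinom_left n k"
proof (cases k)
  case (Suc j)
  show ?thesis
  proof (cases "j = n")
    case False
    then obtain m where m: "n = Suc (j + m)"
      using assms Suc by (metis le_neq_implies_less less_iff_Suc_add Suc_le_mono)
    obtain X where "qbinom n (Suc j) = X * (1 - q ^ Suc m)" "qbinom n j = X * (1 - q ^ Suc j)"
      using qbinom_neighbours[of j m] unfolding m by metis
    then show ?thesis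
      by (simp add: Suc m Suc_diff_le)
  qed (simp add: Suc qbinom_def)
qed simp

lemma qbinom_pascal:
  assumes "k \<le> Suc n"
  shows "qbinom (Suc n) k = q ^ k * qbinom n k + qbinom_left n k"
proof (cases k)
  case (Suc j)
  show ?thesis
  proof (cases "j = n")
    case False
    then obtain m where m: "n = Suc (j + m)"
      using assms Suc by (metis le_neq_implies_less less_iff_Suc_add Suc_le_mono)
    obtain X where X: "qbinom (Suc n) (Suc j) = X * (1 - q ^ Suc n)"
        "qbinom n (Suc j) = X * (1 - q ^ Suc m)" "qbinom n j = X * (1 - q ^ Suc j)"
      using qbinom_neighbours[of j m] unfolding m by metis
    have "q ^ Suc n = q ^ Suc j * q ^ Suc m"
      by (simp add: m power_add)
    then show ?thesis
      unfolding Suc qbinom_left_simps X by (simp add: algebra_simps del: power_Suc)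
  next
    case True
    then show ?thesis
      unfolding Suc qbinom_left_simps by (simp add: qbinom_def[of n] poch_q_nonzero)
  qed
qed simp

text \<open>
  The terminating balanced \<open>3phi2\<close> sum, cleared of denominators. In the usual notation the
  denominator parameters are \<open>\<alpha> \<beta> w\<close> and \<open>q^(1-k)/w\<close>; multiplying by their shifted factorials turns
  both sides into polynomials in \<open>\<alpha>\<close>, \<open>\<beta>\<close>, \<open>w\<close>, so no parameter has to be generic.
  The proof is an induction on \<open>k\<close> in which \<open>w\<close> moves to \<open>q w\<close>: the difference of the two summands
  telescopes.
\<close>
lemma q_saalschuetz:
  "(\<Sum>j\<le>k. qbinom k j * w ^ j * poch \<alpha> j * poch \<beta> j
      * poch (\<alpha> * \<beta> * w * q ^ j) (k - j) * poch w (k - j))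
   = poch (\<alpha> * w) k * poch (\<beta> * w) k"
proof (induction k arbitrary: w)
  case (Suc k)
  define T where "T k w j = qbinom k j * w ^ j * poch \<alpha> j * poch \<beta> j
      * poch (\<alpha> * \<beta> * w * q ^ j) (k - j) * poch w (k - j)" for k w j
  \<comment> \<open>The telescoping certificate. It vanishes at \<open>j = 0\<close>, and at \<open>j = k + 1\<close> it is the last summand.\<close>
  define G where "G j = qbinom_left k j * w ^ j * poch \<alpha> j * poch \<beta> j
      * poch (\<alpha> * \<beta> * w * q ^ j) (Suc k - j) * poch (q * w) (Suc k - j)" for j
  have step: "T (Suc k) w j = (1 - \<alpha> * w) * (1 - \<beta> * w) * T k (q * w) j + (G j - G (Suc j))"
    if jk: "j \<le> k" for j
  proof -
    obtain m where m: "k = j + m"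
      using jk le_Suc_ex by blast
    define X P where "X = qbinom k j" and "P = qbinom_left k j"
    have pas: "qbinom (Suc k) j = q ^ j * X + P"
      using jk by (simp add: qbinom_pascal X_def P_def)
    have ab: "(1 - q ^ j) * X = (1 - q * q ^ m) * P"
      using qbinom_absorb[of j k] by (simp add: X_def P_def m Suc_diff_le)
    define U where "U = w ^ j * poch \<alpha> j * poch \<beta> j * poch (\<alpha> * \<beta> * w * q ^ Suc j) m * poch (q * w) m"
    have e1: "poch (\<alpha> * \<beta> * w * q ^ j) (Suc m)
        = (1 - \<alpha> * \<beta> * w * q ^ j) * poch (\<alpha> * \<beta> * w * q ^ Suc j) m"
      by (simp add: qpoch_Suc_shift mult_ac)
    have e2: "poch w (Suc m) = (1 - w) * poch (q * w) m"
      by (simp add: qpoch_Suc_shift mult_ac)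
    have T1: "T (Suc k) w j = (q ^ j * X + P) * U * (1 - \<alpha> * \<beta> * w * q ^ j) * (1 - w)"
      using pas unfolding T_def m
      by (simp only: e1 e2 diff_add_inverse Suc_diff_le le_add1 U_def) (simp only: mult_ac)
    have T2: "T k (q * w) j = X * q ^ j * U"
      by (simp add: T_def m U_def X_def power_mult_distrib mult_ac)
    have G1: "G j = P * U * (1 - \<alpha> * \<beta> * w * q ^ j) * (1 - q * w * q ^ m)"
      unfolding G_def P_def[symmetric] unfolding m
      by (simp only: e1 qpoch_Suc[of "q * w"] diff_add_inverse Suc_diff_le le_add1 U_def)
        (simp only: mult_ac)
    have G2: "G (Suc j) = X * U * w * (1 - \<alpha> * q ^ j) * (1 - \<beta> * q ^ j)"
      by (simp add: G_def m U_def X_def qpoch_Suc mult_ac)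
    have "T (Suc k) w j = (1 - \<alpha> * w) * (1 - \<beta> * w) * T k (q * w) j + (G j - G (Suc j))
        + w * U * (1 - \<alpha> * \<beta> * w * q ^ j) * ((1 - q ^ j) * X - (1 - q * q ^ m) * P)"
      unfolding T1 T2 G1 G2 by (simp add: algebra_simps)
    then show ?thesis
      by (simp add: ab)
  qed
  have last: "T (Suc k) w (Suc k) = G (Suc k)"
    by (simp add: T_def G_def)
  have "(\<Sum>j\<le>Suc k. T (Suc k) w j)
      = (1 - \<alpha> * w) * (1 - \<beta> * w) * (\<Sum>j\<le>k. T k (q * w) j)
        + (\<Sum>j\<le>k. G j - G (Suc j)) + G (Suc k)"
    by (simp add: step last sum.distrib sum_distrib_left)
  also have "(\<Sum>j\<le>k. G j - G (Suc j)) = - G (Suc k)"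
    unfolding sum_telescope by (simp add: G_def)
  also have "(\<Sum>j\<le>k. T k (q * w) j) = poch (\<alpha> * (q * w)) k * poch (\<beta> * (q * w)) k"
    using Suc.IH[of "q * w"] by (simp add: T_def)
  finally show ?case
    by (simp add: T_def qpoch_Suc_shift mult_ac)
qed simp

section \<open>Transformations of balanced series\<close>

text \<open>
  Where no denominator vanishes, this is \<open>(x, y, g; q)_n\<close> times
  \<open>4phi3(q^-n, c, d, h; x, y, q^(1-n)/g; q, q)\<close>. The series is balanced
  precisely when \<open>x y = c d g h\<close>. Parametrising the third denominator by \<open>g\<close> makes the expression
  a polynomial in all six parameters.
\<close>
definition cleared_phi ::
    "nat \<Rightarrow> complex \<Rightarrow> complex \<Rightarrow> complex \<Rightarrow> complex \<Rightarrow> complex \<Rightarrow> complex \<Rightarrow> complex" where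
  "cleared_phi n c d h x y g =
     (\<Sum>j\<le>n. qbinom n j * g ^ j * poch c j * poch d j * poch h j
        * poch (x * q ^ j) (n - j) * poch (y * q ^ j) (n - j) * poch g (n - j))"

lemma cleared_phi_perm:
  "cleared_phi n d c h x y g = cleared_phi n c d h x y g"
  "cleared_phi n c h d x y g = cleared_phi n c d h x y g"
  "cleared_phi n c d h y x g = cleared_phi n c d h x y g"
  by (simp_all add: cleared_phi_def mult_ac)

text \<open>
  Expanding \<open>(\<alpha> w, \<beta> w; q)_j\<close> by the balanced \<open>3phi2\<close> sum and interchanging the summations leaves
  an inner sum which is again a balanced \<open>3phi2\<close>. In the cleared normalisation the two sides agree
  without any prefactor. With \<open>x = \<alpha> \<beta> w\<close> and \<open>y = c g w\<close> the left-hand side is the general balanced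
  series with non-zero parameters.
\<close>
lemma sears:
  "cleared_phi n c (\<alpha> * w) (\<beta> * w) (\<alpha> * \<beta> * w) (c * g * w) g
   = cleared_phi n c \<alpha> \<beta> (\<alpha> * \<beta> * w) (c * g) (g * w)"
proof -
  define x where "x = \<alpha> * \<beta> * w"
  define f where "f j i = qbinom n j * qbinom j i * g ^ j * w ^ i * poch c j * poch \<alpha> i * poch \<beta> i
      * (poch (x * q ^ i) (j - i) * poch (x * q ^ j) (n - j)) * poch w (j - i)
      * poch (c * g * w * q ^ j) (n - j) * poch g (n - j)" for j i
  have "cleared_phi n c (\<alpha> * w) (\<beta> * w) x (c * g * w) g = (\<Sum>j\<le>n. \<Sum>i\<le>j. f j i)"
    unfolding cleared_phi_def
  proof (rule sum.cong)
    fix j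
    have "qbinom n j * g ^ j * poch c j * poch (\<alpha> * w) j * poch (\<beta> * w) j
        * poch (x * q ^ j) (n - j) * poch (c * g * w * q ^ j) (n - j) * poch g (n - j)
      = qbinom n j * g ^ j * poch c j * poch (x * q ^ j) (n - j)
        * poch (c * g * w * q ^ j) (n - j) * poch g (n - j) * (poch (\<alpha> * w) j * poch (\<beta> * w) j)"
      by (simp add: mult_ac)
    also have "\<dots> = (\<Sum>i\<le>j. f j i)"
      unfolding q_saalschuetz[symmetric] sum_distrib_left
      by (intro sum.cong refl) (simp add: f_def x_def mult_ac)
    finally show "qbinom n j * g ^ j * poch c j * poch (\<alpha> * w) j * poch (\<beta> * w) j
        * poch (x * q ^ j) (n - j) * poch (c * g * w * q ^ j) (n - j) * poch g (n - j)
      = (\<Sum>i\<le>j. f j i)" .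
  qed simp
  also have "\<dots> = (\<Sum>i\<le>n. \<Sum>m\<le>n - i. f (i + m) i)"
    by (rule sum_triangle_shift)
  also have "\<dots> = cleared_phi n c \<alpha> \<beta> x (c * g) (g * w)"
    unfolding cleared_phi_def
  proof (rule sum.cong)
    fix i assume "i \<in> {..n}"
    then have i: "i \<le> n" by simp
    define R where "R = qbinom n i * (g * w) ^ i * poch c i * poch \<alpha> i * poch \<beta> i * poch (x * q ^ i) (n - i)"
    have "f (i + m) i = R * (qbinom (n - i) m * g ^ m * poch (c * q ^ i) m * poch w m
        * poch ((c * q ^ i) * w * g * q ^ m) (n - i - m) * poch g (n - i - m))"
      if "m \<le> n - i" for m
    proof -
      have "qbinom n (i + m) * qbinom (i + m) i = qbinom n i * qbinom (n - i) m"
        using that i by (intro qbinom_mult) simp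
      moreover have "poch (x * q ^ i) m * poch (x * q ^ (i + m)) (n - (i + m)) = poch (x * q ^ i) (n - i)"
        using qpoch_add[of "x * q ^ i" q m "n - (i + m)"] that i by (simp add: power_add mult_ac)
      ultimately show ?thesis
        by (simp add: f_def R_def qpoch_add[of c] power_add power_mult_distrib mult_ac)
    qed
    then have "(\<Sum>m\<le>n - i. f (i + m) i)
        = R * (poch (c * q ^ i * g) (n - i) * poch (w * g) (n - i))"
      unfolding q_saalschuetz[symmetric] sum_distrib_left by simp
    then show "(\<Sum>m\<le>n - i. f (i + m) i)
      = qbinom n i * (g * w) ^ i * poch c i * poch \<alpha> i * poch \<beta> i
        * poch (x * q ^ i) (n - i) * poch (c * g * q ^ i) (n - i) * poch (g * w) (n - i)"
      by (simp add: R_def mult_ac)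
  qed simp
  finally show ?thesis
    by (simp add: x_def)
qed

text \<open>
  Reading the sum from \<open>j = n\<close> down to \<open>j = 0\<close> gives a series of the same kind, in which
  numerator and denominator parameters have exchanged their roles. The numerator parameter \<open>c\<close>
  and the hidden denominator parameter \<open>g\<close> trade places. Balancedness makes the
  \<open>j\<close>-dependent powers collect to \<open>c^j\<close>.
\<close>
lemma cleared_phi_reverse:
  fixes n :: nat and c d h x y g :: complex
  assumes "x * y = c * d * h * g" "x \<noteq> 0" "y \<noteq> 0" "d \<noteq> 0" "h \<noteq> 0"
  defines "v \<equiv> q / q ^ n"
  shows "cleared_phi n c d h x y g
       = qsign q n ^ 2 * (g * d * h) ^ n * cleared_phi n g (v / x) (v / y) (v / d) (v / h) c"
proof -
  have "cleared_phi n c d h x y g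
      = (\<Sum>j\<le>n. qbinom n j * g ^ (n - j) * poch c (n - j) * poch d (n - j) * poch h (n - j)
        * poch (x * q ^ (n - j)) j * poch (y * q ^ (n - j)) j * poch g j)"
    unfolding cleared_phi_def
    by (rule sum.reindex_bij_witness[of _ "\<lambda>j. n - j" "\<lambda>j. n - j"]) (auto simp: qbinom_symmetric)
  also have "\<dots> = (\<Sum>j\<le>n. qsign q n ^ 2 * (g * d * h) ^ n * (qbinom n j * c ^ j * poch g j
        * poch (v / x) j * poch (v / y) j
        * poch (v / d * q ^ j) (n - j) * poch (v / h * q ^ j) (n - j) * poch c (n - j)))"
  proof (rule sum.cong)
    fix j assume "j \<in> {..n}"
    then obtain m where m: "n = j + m"
      using le_Suc_ex by auto
    have up: "poch z m = qsign q m * z ^ m * poch (v / z * q ^ j) m" if "z \<noteq> 0" for z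
    proof -
      have "q / (q ^ m * z) = v / z * q ^ j"
        using q_nonzero by (simp add: v_def m power_add)
      then show ?thesis
        using qpoch_flip[of q z m] q_nonzero that by simp
    qed
    have lo: "poch (z * q ^ m) j = qsign q j * q ^ (m * j) * z ^ j * poch (v / z) j" if "z \<noteq> 0" for z
      using qpoch_shift_flip[of q z m j] q_nonzero that by (simp add: v_def m)
    have sgn: "qsign q m * (qsign q j * q ^ (m * j)) = qsign q n"
      by (simp add: m qsign_add mult_ac)
    have "g ^ m * (d ^ m * h ^ m) * (x ^ j * y ^ j) = (g * d * h) ^ n * c ^ j"
      unfolding power_mult_distrib[symmetric] assms(1) by (simp add: m power_add power_mult_distrib mult_ac)
    moreover have "qbinom n j * g ^ m * poch c m * poch d m * poch h m
        * poch (x * q ^ m) j * poch (y * q ^ m) j * poch g j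
      = (qsign q m * (qsign q j * q ^ (m * j))) ^ 2 * (g ^ m * (d ^ m * h ^ m) * (x ^ j * y ^ j))
        * (qbinom n j * poch g j * poch (v / x) j * poch (v / y) j
        * poch (v / d * q ^ j) m * poch (v / h * q ^ j) m * poch c m)"
      by (simp only: up[OF assms(4)] up[OF assms(5)] lo[OF assms(2)] lo[OF assms(3)])
        (simp only: power2_eq_square mult_ac)
    ultimately show "qbinom n j * g ^ (n - j) * poch c (n - j) * poch d (n - j) * poch h (n - j)
        * poch (x * q ^ (n - j)) j * poch (y * q ^ (n - j)) j * poch g j
      = qsign q n ^ 2 * (g * d * h) ^ n * (qbinom n j * c ^ j * poch g j
        * poch (v / x) j * poch (v / y) j
        * poch (v / d * q ^ j) (n - j) * poch (v / h * q ^ j) (n - j) * poch c (n - j))"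
      unfolding sgn by (simp add: m mult_ac)
  qed simp
  also have "\<dots> = qsign q n ^ 2 * (g * d * h) ^ n * cleared_phi n g (v / x) (v / y) (v / d) (v / h) c"
    by (simp only: cleared_phi_def sum_distrib_left)
  finally show ?thesis .
qed

lemma qsign_square_eq: "qsign q n ^ 2 * (q / q ^ n) ^ n = 1"
proof -
  have "qsign q n ^ 2 * (q / q ^ n) ^ n = (qsign q n * qsign q n * q ^ n) / q ^ (n * n)"
    by (simp add: power2_eq_square power_divide power_mult)
  then show ?thesis
    by (simp add: qsign_square q_nonzero)
qed

text \<open>
  The three denominator parameters \<open>x\<close>, \<open>y\<close>, \<open>q^(1-n)/g\<close> of the \<open>4phi3\<close> are symmetric, but the
  normalisation singles out \<open>g\<close>. Changing the distinguished parameter costs a power, obtained here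
  by reversing the sum twice with two different choices of the parameter that is exchanged with \<open>g\<close>.
\<close>
lemma cleared_phi_exchange:
  fixes n :: nat and c d h x y g :: complex
  assumes "x * y = c * d * h * g" "x \<noteq> 0" "y \<noteq> 0" "d \<noteq> 0" "h \<noteq> 0" "g \<noteq> 0"
  defines "v \<equiv> q / q ^ n"
  shows "cleared_phi n c d h x y g = (g * y / v) ^ n * cleared_phi n c d h x (v / g) (v / y)"
proof -
  have v: "v \<noteq> 0"
    using q_nonzero by (simp add: v_def)
  have "cleared_phi n c d h x y g
      = qsign q n ^ 2 * (g * d * h) ^ n * cleared_phi n g (v / x) (v / y) (v / d) (v / h) c"
    unfolding v_def by (rule cleared_phi_reverse) (use assms in auto)
  also have "cleared_phi n g (v / x) (v / y) (v / d) (v / h) c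
      = cleared_phi n (v / y) g (v / x) (v / d) (v / h) c"
    by (simp only: cleared_phi_def mult_ac)
  also have "\<dots> = qsign q n ^ 2 * (c * g * (v / x)) ^ n
      * cleared_phi n c (v / (v / d)) (v / (v / h)) (v / g) (v / (v / x)) (v / y)"
    unfolding v_def by (rule cleared_phi_reverse) (use assms q_nonzero in \<open>auto simp: field_simps\<close>)
  also have "cleared_phi n c (v / (v / d)) (v / (v / h)) (v / g) (v / (v / x)) (v / y)
      = cleared_phi n c d h x (v / g) (v / y)"
    using v by (simp add: cleared_phi_def mult_ac)
  finally have "cleared_phi n c d h x y g
      = (qsign q n ^ 2) ^ 2 * ((g * d * h) * (c * g * (v / x))) ^ n * cleared_phi n c d h x (v / g) (v / y)"
    by (simp only: power_mult_distrib power2_eq_square mult_ac)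
  also have "(g * d * h) * (c * g * (v / x)) = (g * y / v) * v ^ 2"
    using assms(1,2) v by (simp add: field_simps power2_eq_square)
  also have "(qsign q n ^ 2) ^ 2 * ((g * y / v) * v ^ 2) ^ n
      = (qsign q n ^ 2 * v ^ n) ^ 2 * (g * y / v) ^ n"
    by (simp only: power_mult_distrib mult_ac flip: power_mult)
  also have "qsign q n ^ 2 * v ^ n = 1"
    unfolding v_def by (rule qsign_square_eq)
  finally show ?thesis
    by simp
qed

section \<open>Watson's transformation\<close>

text \<open>
  The terminating very-well-poised \<open>6phi5\<close> sum, cleared of the denominators in \<open>c\<close> and \<open>d\<close>. The
  quotient \<open>(1 - b q^(2m)) / (b q^m; q)_(n+1)\<close> times a Gaussian binomial splits into two terms
  that belong to \<open>n\<close> and to the parameter \<open>b q\<close>. Collecting neighbouring summands produces the factor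
  \<open>(1 - b q/(c d)) (1 - b q^(2m+1))\<close>, whose second half is the very-well-poised factor for
  \<open>b q\<close>; thus the sum for \<open>n + 1\<close> and \<open>b\<close> is \<open>1 - b q/(c d)\<close> times the sum for \<open>n\<close> and \<open>b q\<close>.
\<close>
lemma very_well_poised_6phi5_sum:
  assumes "\<And>i. i \<le> 2 * n \<Longrightarrow> b * q ^ i \<noteq> 1" "c \<noteq> 0" "d \<noteq> 0"
  shows "(\<Sum>m\<le>n. qbinom n m * (qsign q m * q ^ m) * (b / (c * d)) ^ m * poch c m * poch d m
      * poch (b / c * q ^ Suc m) (n - m) * poch (b / d * q ^ Suc m) (n - m)
      * ((1 - b * q ^ (2 * m)) / poch (b * q ^ m) (Suc n)))
    = poch (b * q / (c * d)) n"
  using assms(1)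
proof (induction n arbitrary: b)
  case 0
  from 0[of 0] show ?case by (simp add: qpoch_Suc)
next
  case (Suc n)
  define u where "u m = qsign q m * q ^ m * (b / (c * d)) ^ m * poch c m * poch d m
      * poch (b / c * q ^ Suc m) (Suc n - m) * poch (b / d * q ^ Suc m) (Suc n - m)" for m
  have nz: "poch (b * q ^ m) k \<noteq> 0" if "m + k \<le> Suc (2 * Suc n)" for m k
    using Suc.prems that by (auto simp: qpoch_eq_0_iff mult.assoc simp flip: power_add)
  have split: "qbinom (Suc n) m * ((1 - b * q ^ (2 * m)) / poch (b * q ^ m) (Suc (Suc n)))
      = q ^ m * qbinom n m / poch (b * q ^ Suc m) (Suc n) + qbinom_left n m / poch (b * q ^ m) (Suc n)"
    if m: "m \<le> Suc n" for m
  proof -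
    define X P where "X = qbinom n m" and "P = qbinom_left n m"
    define Y where "Y = poch (b * q ^ Suc m) n"
    obtain s where s: "s = 1 - b * q ^ m" by blast
    obtain t where t: "t = 1 - b * q ^ (m + Suc n)" by blast
    have p1: "poch (b * q ^ m) (Suc n) = s * Y"
      by (simp add: qpoch_Suc_shift s Y_def mult_ac)
    have p2: "poch (b * q ^ Suc m) (Suc n) = Y * t"
      by (simp add: qpoch_Suc t Y_def power_add mult_ac)
    have p3: "poch (b * q ^ m) (Suc (Suc n)) = s * Y * t"
      using p1 by (simp add: qpoch_Suc[of _ _ "Suc n"] t power_add mult_ac)
    have "s * Y * t \<noteq> 0"
      using nz[of m "Suc (Suc n)"] m unfolding p3 by simp
    then have [simp]: "s \<noteq> 0" "t \<noteq> 0" "Y \<noteq> 0" by auto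
    have ab: "(1 - q ^ m) * X = (1 - q ^ (Suc n - m)) * P"
      using qbinom_absorb[OF m] by (simp add: X_def P_def)
    have qq: "q ^ (m + Suc n) = q ^ m * q ^ m * q ^ (Suc n - m)"
      using m by (simp flip: power_add)
    have "(q ^ m * X + P) * (1 - b * q ^ (2 * m)) = q ^ m * X * s + P * t"
    proof -
      have "(q ^ m * X + P) * (1 - b * (q ^ m * q ^ m)) = q ^ m * X * (1 - b * q ^ m)
          + P * (1 - b * (q ^ m * q ^ m * q ^ (Suc n - m)))
          + b * (q ^ m * q ^ m) * ((1 - q ^ m) * X - (1 - q ^ (Suc n - m)) * P)"
        by (simp add: algebra_simps)
      then show ?thesis
        unfolding s t qq mult_2 power_add[of q m m] ab by simp
    qed
    then have "(q ^ m * X + P) * ((1 - b * q ^ (2 * m)) / (s * Y * t)) = (q ^ m * X * s + P * t) / (s * Y * t)"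
      by (simp only: times_divide_eq_right)
    also have "\<dots> = q ^ m * X / (Y * t) + P / (s * Y)"
      by (simp add: field_simps)
    finally have "(q ^ m * X + P) * ((1 - b * q ^ (2 * m)) / (s * Y * t)) = q ^ m * X / (Y * t) + P / (s * Y)" .
    then show ?thesis
      unfolding p1 p2 p3 qbinom_pascal[OF m] X_def P_def .
  qed
  have pair: "q ^ m * u m + u (Suc m)
      = (1 - b * q / (c * d)) * (qsign q m * q ^ m * (b * q / (c * d)) ^ m * poch c m * poch d m
        * poch (b * q / c * q ^ Suc m) (n - m) * poch (b * q / d * q ^ Suc m) (n - m)
        * (1 - b * q * q ^ (2 * m)))"
    if m: "m \<le> n" for m
  proof -
    define Z where "Z = qsign q m * q ^ m * (b * q / (c * d)) ^ m * poch c m * poch d m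
        * poch (b * q / c * q ^ Suc m) (n - m) * poch (b * q / d * q ^ Suc m) (n - m)"
    have 1: "q ^ m * u m = Z * ((1 - b / c * q * q ^ m) * (1 - b / d * q * q ^ m))"
      unfolding u_def Suc_diff_le[OF m] qpoch_Suc_shift Z_def
      by (simp add: power_mult_distrib power_divide mult_ac)
    have 2: "u (Suc m) = - (Z * (b * q / (c * d) * (1 - c * q ^ m) * (1 - d * q ^ m)))"
      unfolding u_def Z_def
      by (simp add: qpoch_Suc[of c] qpoch_Suc[of d] qsign_Suc power_mult_distrib power_divide mult_ac)
    have 3: "(1 - b / c * q * q ^ m) * (1 - b / d * q * q ^ m) - b * q / (c * d) * (1 - c * q ^ m) * (1 - d * q ^ m)
        = (1 - b * q / (c * d)) * (1 - b * q * q ^ (2 * m))"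
      using assms(2,3) unfolding mult_2 power_add by (simp add: field_simps)
    have factor: "Z * s + - (Z * t) = Z * (s - t)" for s t
      by (simp add: algebra_simps)
    have "q ^ m * u m + u (Suc m) = Z * ((1 - b / c * q * q ^ m) * (1 - b / d * q * q ^ m)
        - b * q / (c * d) * (1 - c * q ^ m) * (1 - d * q ^ m))"
      unfolding 1 2 by (rule factor)
    then show ?thesis
      unfolding 3 Z_def by (simp only: mult_ac)
  qed
  have "(\<Sum>m\<le>Suc n. qbinom (Suc n) m * (qsign q m * q ^ m) * (b / (c * d)) ^ m * poch c m * poch d m
      * poch (b / c * q ^ Suc m) (Suc n - m) * poch (b / d * q ^ Suc m) (Suc n - m)
      * ((1 - b * q ^ (2 * m)) / poch (b * q ^ m) (Suc (Suc n))))
    = (\<Sum>m\<le>Suc n. u m * (qbinom (Suc n) m * ((1 - b * q ^ (2 * m)) / poch (b * q ^ m) (Suc (Suc n)))))"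
    by (simp only: u_def mult_ac)
  also have "\<dots> = (\<Sum>m\<le>Suc n. u m * q ^ m * qbinom n m / poch (b * q ^ Suc m) (Suc n))
      + (\<Sum>m\<le>Suc n. u m * qbinom_left n m / poch (b * q ^ m) (Suc n))"
    unfolding sum.distrib[symmetric]
  proof (rule sum.cong)
    fix m assume "m \<in> {..Suc n}"
    then show "u m * (qbinom (Suc n) m * ((1 - b * q ^ (2 * m)) / poch (b * q ^ m) (Suc (Suc n))))
        = u m * q ^ m * qbinom n m / poch (b * q ^ Suc m) (Suc n)
          + u m * qbinom_left n m / poch (b * q ^ m) (Suc n)"
      by (subst split) (simp_all only: atMost_iff distrib_left times_divide_eq_right mult.assoc)
  qed simp
  also have "(\<Sum>m\<le>Suc n. u m * q ^ m * qbinom n m / poch (b * q ^ Suc m) (Suc n))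
      = (\<Sum>m\<le>n. u m * q ^ m * qbinom n m / poch (b * q ^ Suc m) (Suc n))"
    by (simp add: qbinom_def[of n "Suc n"])
  also have "(\<Sum>m\<le>Suc n. u m * qbinom_left n m / poch (b * q ^ m) (Suc n))
      = (\<Sum>m\<le>n. u (Suc m) * qbinom n m / poch (b * q ^ Suc m) (Suc n))"
    by (subst sum.atMost_Suc_shift) simp
  also have "(\<Sum>m\<le>n. u m * q ^ m * qbinom n m / poch (b * q ^ Suc m) (Suc n))
      + (\<Sum>m\<le>n. u (Suc m) * qbinom n m / poch (b * q ^ Suc m) (Suc n))
      = (\<Sum>m\<le>n. (q ^ m * u m + u (Suc m)) * qbinom n m / poch (b * q ^ Suc m) (Suc n))"
    unfolding sum.distrib[symmetric] by (simp add: ring_distribs add_divide_distrib mult_ac)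
  also have "\<dots> = (1 - b * q / (c * d)) * (\<Sum>m\<le>n. qbinom n m * (qsign q m * q ^ m)
      * (b * q / (c * d)) ^ m * poch c m * poch d m
      * poch (b * q / c * q ^ Suc m) (n - m) * poch (b * q / d * q ^ Suc m) (n - m)
      * ((1 - b * q * q ^ (2 * m)) / poch (b * q * q ^ m) (Suc n)))"
    unfolding sum_distrib_left
  proof (rule sum.cong)
    fix m assume "m \<in> {..n}"
    then have m: "m \<le> n"
      by simp
    have "b * q ^ Suc m = b * q * q ^ m"
      by simp
    then show "(q ^ m * u m + u (Suc m)) * qbinom n m / poch (b * q ^ Suc m) (Suc n)
      = (1 - b * q / (c * d)) * (qbinom n m * (qsign q m * q ^ m)
      * (b * q / (c * d)) ^ m * poch c m * poch d m
      * poch (b * q / c * q ^ Suc m) (n - m) * poch (b * q / d * q ^ Suc m) (n - m)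
      * ((1 - b * q * q ^ (2 * m)) / poch (b * q * q ^ m) (Suc n)))"
      unfolding pair[OF m] by (simp only: times_divide_eq_left times_divide_eq_right mult_ac)
  qed simp
  also have "\<dots> = (1 - b * q / (c * d)) * poch (b * q * q / (c * d)) n"
    using Suc.prems[of "Suc i" for i] by (subst Suc.IH) (auto simp: mult_ac)
  finally show ?case
    by (simp add: qpoch_Suc_shift mult_ac)
qed

text \<open>
  The balanced \<open>3phi2\<close> sum with \<open>\<alpha> = b q^k\<close>, \<open>\<beta> = q b/(e f)\<close>, arranged so that a pair of
  well-poised parameters of an \<open>8W7\<close> appears on the left.
\<close>
lemma well_poised_saalschuetz:
  assumes "b \<noteq> 0" "e \<noteq> 0" "f \<noteq> 0"
  shows "poch e k * poch f k * (q * b / (e * f)) ^ k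
       = (\<Sum>j\<le>k. qbinom k j * poch (b * q ^ k) j * poch (q * b / (e * f)) j
          * poch (b / e * q ^ Suc j) (k - j) * poch (b / f * q ^ Suc j) (k - j)
          * (qsign q j * q ^ j / q ^ (k * j)))"
proof -
  define w where "w = f / (b * q ^ k)"
  have qk: "q ^ i \<noteq> 0" for i
    using q_nonzero by simp
  have w0: "w \<noteq> 0"
    using assms q_nonzero by (simp add: w_def)
  have args: "b * q ^ k * w = f" "q * b / (e * f) * w = q / (q ^ k * e)"
      "b * q ^ k * (q * b / (e * f)) * w = b / e * q"
    using assms q_nonzero by (simp_all add: w_def)
  have base: "q * b / (e * f) * e * w = q / q ^ k"
    using assms q_nonzero by (simp add: w_def)
  have "poch e k * poch f k * (q * b / (e * f)) ^ k
      = qsign q k * (q * b / (e * f) * e) ^ k * (poch f k * poch (q / (q ^ k * e)) k)"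
    unfolding power_mult_distrib by (subst qpoch_flip[of q e k]) (use assms q_nonzero in auto)
  also have "poch f k * poch (q / (q ^ k * e)) k
      = (\<Sum>j\<le>k. qbinom k j * w ^ j * poch (b * q ^ k) j * poch (q * b / (e * f)) j
          * poch (b / e * q * q ^ j) (k - j) * poch w (k - j))"
    using q_saalschuetz[of k w "b * q ^ k" "q * b / (e * f)"] unfolding args by simp
  also have "qsign q k * (q * b / (e * f) * e) ^ k * \<dots>
      = (\<Sum>j\<le>k. qbinom k j * poch (b * q ^ k) j * poch (q * b / (e * f)) j
          * poch (b / e * q ^ Suc j) (k - j) * poch (b / f * q ^ Suc j) (k - j)
          * (qsign q j * q ^ j / q ^ (k * j)))"
    unfolding sum_distrib_left
  proof (rule sum.cong)
    fix j assume "j \<in> {..k}"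
    then obtain m where m: "k = j + m"
      using le_Suc_ex by auto
    have "q / (q ^ m * w) = b / f * q ^ Suc j"
      using assms q_nonzero by (simp add: w_def m power_add)
    then have fl: "poch w m = qsign q m * w ^ m * poch (b / f * q ^ Suc j) m"
      using qpoch_flip[of q w m] q_nonzero w0 by simp
    have "qsign q m * q ^ (k * j) = qsign q k * (qsign q j * q ^ j)"
      using qsign_square[of q j] by (simp add: m qsign_add power_add mult_ac ring_distribs)
    then have "qsign q m = qsign q k * (qsign q j * q ^ j / q ^ (k * j))"
      using q_nonzero by (simp add: field_simps)
    moreover have "(q * b / (e * f) * e) ^ k * (w ^ j * w ^ m) = (q / q ^ k) ^ k"
      unfolding base[symmetric] by (simp add: m power_add power_mult_distrib)
    ultimately have "qsign q k * ((q * b / (e * f) * e) ^ k * (w ^ j * w ^ m)) * qsign q m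
        = qsign q k ^ 2 * (q / q ^ k) ^ k * (qsign q j * q ^ j / q ^ (k * j))"
      by (simp only: power2_eq_square mult_ac)
    then have c: "qsign q k * ((q * b / (e * f) * e) ^ k * (w ^ j * w ^ m)) * qsign q m
        = qsign q j * q ^ j / q ^ (k * j)"
      by (simp add: qsign_square_eq)
    show "qsign q k * (q * b / (e * f) * e) ^ k
          * (qbinom k j * w ^ j * poch (b * q ^ k) j * poch (q * b / (e * f)) j
          * poch (b / e * q * q ^ j) (k - j) * poch w (k - j))
      = qbinom k j * poch (b * q ^ k) j * poch (q * b / (e * f)) j
          * poch (b / e * q ^ Suc j) (k - j) * poch (b / f * q ^ Suc j) (k - j)
          * (qsign q j * q ^ j / q ^ (k * j))"
      unfolding c[symmetric] by (simp add: m fl mult_ac)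
  qed simp
  finally show ?thesis .
qed

text \<open>
  The product of \<open>(q b/t; q)_n\<close> over \<open>t = c, d, e, f\<close> times
  \<open>8W7(b; q^-n, c, d, e, f; q, q^(n+2) b^2/(c d e f))\<close>, divided by \<open>(q b; q)_n\<close>. The last factor of
  the summand collects \<open>(b; q)_k\<close>, \<open>(q^(n+1) b; q)_k\<close> and the very-well-poised part.
\<close>
definition cleared_W :: "nat \<Rightarrow> complex \<Rightarrow> complex \<Rightarrow> complex \<Rightarrow> complex \<Rightarrow> complex \<Rightarrow> complex" where
  "cleared_W n b c d e f =
     (\<Sum>k\<le>n. qbinom n k * (qsign q k * q ^ (2 * k)) * (b\<^sup>2 / (c * d * e * f)) ^ k
        * (poch c k * poch (b / c * q ^ Suc k) (n - k)) * (poch d k * poch (b / d * q ^ Suc k) (n - k))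
        * (poch e k * poch (b / e * q ^ Suc k) (n - k)) * (poch f k * poch (b / f * q ^ Suc k) (n - k))
        * ((1 - b * q ^ (2 * k)) / poch (b * q ^ k) (Suc n)))"

text \<open>
  Expanding the pair \<open>e, f\<close> by the well-poised form of the balanced \<open>3phi2\<close> sum and interchanging
  the summations leaves very-well-poised \<open>6phi5\<close> sums with base parameter \<open>b q^(2j)\<close> and the
  parameters \<open>c q^j\<close>, \<open>d q^j\<close>. Evaluating them yields a balanced \<open>4phi3\<close> in cleared form.
\<close>
lemma watson:
  assumes "\<And>i. i \<le> 2 * n \<Longrightarrow> b * q ^ i \<noteq> 1" "b \<noteq> 0" "c \<noteq> 0" "d \<noteq> 0" "e \<noteq> 0" "f \<noteq> 0"
  shows "cleared_W n b c d e f
       = cleared_phi n c d (q * b / (e * f)) (q * b / e) (q * b / f) (q * b / (c * d))"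
proof -
  define V where "V k = (1 - b * q ^ (2 * k)) / poch (b * q ^ k) (Suc n)" for k
  define F where "F k j = qbinom n k * qbinom k j * (qsign q k * q ^ k) * (b / (c * d)) ^ k
      * poch c k * poch d k * poch (b / c * q ^ Suc k) (n - k) * poch (b / d * q ^ Suc k) (n - k)
      * (V k * poch (b * q ^ k) j) * poch (q * b / (e * f)) j
      * (poch (b / e * q ^ Suc j) (k - j) * poch (b / e * q ^ Suc k) (n - k))
      * (poch (b / f * q ^ Suc j) (k - j) * poch (b / f * q ^ Suc k) (n - k))
      * (qsign q j * q ^ j / q ^ (k * j))" for k j
  have nz: "poch (b * q ^ m) k \<noteq> 0" if "m + k \<le> Suc (2 * n)" for m k
    using assms(1) that by (auto simp: qpoch_eq_0_iff mult.assoc simp flip: power_add)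
  have "cleared_W n b c d e f = (\<Sum>k\<le>n. \<Sum>j\<le>k. F k j)"
    unfolding cleared_W_def V_def[symmetric]
  proof (rule sum.cong)
    fix k
    have "(b\<^sup>2 / (c * d * e * f)) ^ k * q ^ (2 * k) = (b / (c * d)) ^ k * q ^ k * (q * b / (e * f)) ^ k"
      unfolding mult_2 power_add power2_eq_square by (simp add: power_mult_distrib power_divide mult_ac)
    then have "qbinom n k * (qsign q k * q ^ (2 * k)) * (b\<^sup>2 / (c * d * e * f)) ^ k
        * (poch c k * poch (b / c * q ^ Suc k) (n - k)) * (poch d k * poch (b / d * q ^ Suc k) (n - k))
        * (poch e k * poch (b / e * q ^ Suc k) (n - k)) * (poch f k * poch (b / f * q ^ Suc k) (n - k)) * V k
      = qbinom n k * (qsign q k * q ^ k) * (b / (c * d)) ^ k * poch c k * poch d k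
        * poch (b / c * q ^ Suc k) (n - k) * poch (b / d * q ^ Suc k) (n - k)
        * poch (b / e * q ^ Suc k) (n - k) * poch (b / f * q ^ Suc k) (n - k) * V k
        * (poch e k * poch f k * (q * b / (e * f)) ^ k)"
      by (simp only: mult_ac)
    also have "\<dots> = (\<Sum>j\<le>k. F k j)"
      unfolding well_poised_saalschuetz[OF assms(2,5,6)] sum_distrib_left
      by (intro sum.cong refl) (simp only: F_def mult_ac)
    finally show "qbinom n k * (qsign q k * q ^ (2 * k)) * (b\<^sup>2 / (c * d * e * f)) ^ k
        * (poch c k * poch (b / c * q ^ Suc k) (n - k)) * (poch d k * poch (b / d * q ^ Suc k) (n - k))
        * (poch e k * poch (b / e * q ^ Suc k) (n - k)) * (poch f k * poch (b / f * q ^ Suc k) (n - k)) * V k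
      = (\<Sum>j\<le>k. F k j)" .
  qed simp
  also have "\<dots> = (\<Sum>j\<le>n. \<Sum>m\<le>n - j. F (j + m) j)"
    by (rule sum_triangle_shift)
  also have "\<dots> = cleared_phi n c d (q * b / (e * f)) (q * b / e) (q * b / f) (q * b / (c * d))"
    unfolding cleared_phi_def
  proof (rule sum.cong)
    fix j assume "j \<in> {..n}"
    then obtain N where N: "n = j + N"
      using le_Suc_ex by auto
    define R where "R = qbinom n j * (b / (c * d)) ^ j * q ^ j * poch c j * poch d j
        * poch (q * b / (e * f)) j * poch (b / e * q ^ Suc j) N * poch (b / f * q ^ Suc j) N"
    define B C D where "B = b * q ^ (2 * j)" and "C = c * q ^ j" and "D = d * q ^ j"
    have "F (j + m) j = R * (qbinom N m * (qsign q m * q ^ m) * (B / (C * D)) ^ m * poch C m * poch D m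
        * poch (B / C * q ^ Suc m) (N - m) * poch (B / D * q ^ Suc m) (N - m)
        * ((1 - B * q ^ (2 * m)) / poch (B * q ^ m) (Suc N)))"
      if "m \<le> N" for m
    proof -
      have qb: "qbinom n (j + m) * qbinom (j + m) j = qbinom n j * qbinom N m"
        using that qbinom_mult[of j m n] by (simp add: N)
      have args: "B / C * q ^ Suc m = b / c * q ^ Suc (j + m)" "B / D * q ^ Suc m = b / d * q ^ Suc (j + m)"
          "B / (C * D) = b / (c * d)" "B * q ^ (2 * m) = b * q ^ (2 * (j + m))" "B * q ^ m = b * q ^ (j + m) * q ^ j"
        using q_nonzero by (simp_all add: B_def C_def D_def mult_2 power_add)
      have cat: "poch (z * q ^ Suc j) m * poch (z * q ^ Suc (j + m)) (N - m) = poch (z * q ^ Suc j) N" for z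
        using qpoch_add[of "z * q ^ Suc j" q m "N - m"] that by (simp add: power_add mult_ac)
      have "poch (b * q ^ (j + m)) (Suc n) = poch (b * q ^ (j + m)) j * poch (b * q ^ (j + m) * q ^ j) (Suc N)"
        using qpoch_add[of "b * q ^ (j + m)" q j "Suc N"] by (simp add: N)
      moreover have "poch (b * q ^ (j + m)) j \<noteq> 0"
        using that by (intro nz) (simp add: N)
      ultimately have v: "V (j + m) * poch (b * q ^ (j + m)) j
          = (1 - B * q ^ (2 * m)) / poch (B * q ^ m) (Suc N)"
        unfolding args V_def by simp
      have sg: "qsign q (j + m) * q ^ (j + m) * (qsign q j * q ^ j / q ^ ((j + m) * j)) = qsign q m * q ^ m * q ^ j"
      proof -
        have "qsign q (j + m) * q ^ (j + m) * (qsign q j * q ^ j)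
            = (qsign q j * qsign q j * q ^ j) * qsign q m * q ^ (j * m) * q ^ m * q ^ j"
          by (simp add: qsign_add power_add mult_ac)
        also have "\<dots> = qsign q m * q ^ m * q ^ j * q ^ ((j + m) * j)"
          unfolding qsign_square by (simp add: power_add ring_distribs mult_ac)
        finally show ?thesis
          using q_nonzero by (simp add: field_simps)
      qed
      have "F (j + m) j = (qbinom n (j + m) * qbinom (j + m) j)
          * (qsign q (j + m) * q ^ (j + m) * (qsign q j * q ^ j / q ^ ((j + m) * j)))
          * (b / (c * d)) ^ (j + m) * poch c (j + m) * poch d (j + m)
          * poch (b / c * q ^ Suc (j + m)) (N - m) * poch (b / d * q ^ Suc (j + m)) (N - m)
          * (V (j + m) * poch (b * q ^ (j + m)) j) * poch (q * b / (e * f)) j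
          * (poch (b / e * q ^ Suc j) m * poch (b / e * q ^ Suc (j + m)) (N - m))
          * (poch (b / f * q ^ Suc j) m * poch (b / f * q ^ Suc (j + m)) (N - m))"
        unfolding F_def N by (simp only: add_diff_cancel_left add_diff_cancel_left' mult_ac)
      then show ?thesis
        unfolding qb sg v cat
        unfolding args(1-3) R_def qpoch_add[of c] qpoch_add[of d] C_def[symmetric] D_def[symmetric] power_add
        by (simp only: mult_ac)
    qed
    then have "(\<Sum>m\<le>n - j. F (j + m) j)
        = R * (\<Sum>m\<le>N. qbinom N m * (qsign q m * q ^ m) * (B / (C * D)) ^ m * poch C m * poch D m
        * poch (B / C * q ^ Suc m) (N - m) * poch (B / D * q ^ Suc m) (N - m)
        * ((1 - B * q ^ (2 * m)) / poch (B * q ^ m) (Suc N)))"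
      by (simp add: N sum_distrib_left)
    also have "\<dots> = R * poch (B * q / (C * D)) N"
    proof (subst very_well_poised_6phi5_sum)
      show "B * q ^ i \<noteq> 1" if "i \<le> 2 * N" for i
        using assms(1)[of "2 * j + i"] that by (simp add: B_def N power_add mult.assoc)
    qed (use assms q_nonzero in \<open>simp_all add: C_def D_def\<close>)
    also have "B * q / (C * D) = q * b / (c * d)"
      using q_nonzero by (simp add: B_def C_def D_def mult_2 power_add)
    finally show "(\<Sum>m\<le>n - j. F (j + m) j)
      = qbinom n j * (q * b / (c * d)) ^ j * poch c j * poch d j * poch (q * b / (e * f)) j
        * poch (q * b / e * q ^ j) (n - j) * poch (q * b / f * q ^ j) (n - j) * poch (q * b / (c * d)) (n - j)"
      by (simp add: R_def N power_mult_distrib power_divide mult_ac)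
  qed simp
  finally show ?thesis .
qed

end

section \<open>Series with denominators\<close>

lemma qpochs_simps [simp]:
  "qpochs [] q n = 1" "qpochs (a # as) q n = qpoch a q n * qpochs as q n"
  by (simp_all add: qpochs_def)

lemma qpochs_mset: "mset as = mset bs \<Longrightarrow> qpochs as q n = qpochs bs q n"
  unfolding qpochs_def by (metis mset_map prod_mset_prod_list)

text \<open>
  The series see their parameter lists only through products over the entries, so the lists may be
  reordered freely.
\<close>
lemma qhyp_mset: "mset as = mset as' \<Longrightarrow> mset bs = mset bs' \<Longrightarrow> qhyp n q as bs z = qhyp n q as' bs' z"
  unfolding qhyp_def by (intro sum.cong refl arg_cong2[of _ _ _ _ "(*)"] arg_cong2[of _ _ _ _ "(/)"] qpochs_mset) simp_all

lemma W87_mset: "mset cs = mset cs' \<Longrightarrow> W87 n q b s cs z = W87 n q b s cs' z"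
  unfolding W87_def W_upper_def W_lower_def by (intro qhyp_mset) simp_all

lemma admissible_iff_qpoch:
  assumes "q \<noteq> 0"
  shows "admissible n q bs \<longleftrightarrow> (\<forall>b\<in>set bs. qpoch b q n \<noteq> 0)"
proof -
  have "b = q powi (- int k) \<longleftrightarrow> b * q ^ k = 1" for b k
    using assms by (auto simp: power_int_minus field_simps)
  then show ?thesis
    by (auto simp: admissible_def qpoch_eq_0_iff)
qed

context not_root_of_unity
begin

lemma qpoch_negative_power:
  assumes "n = j + m"
  shows "qpoch (q powi (- int n)) q j / poch q j = qbinom n j / (qsign q j * q ^ (m * j) * q ^ j)"
proof -
  have "poch (q * q ^ m) j = qsign q j * q ^ (m * j) * q ^ j * poch (q powi (- int n)) j"
  proof -
    have "q / (q ^ (j + m) * q) = q powi (- int n)"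
      using q_nonzero by (simp add: assms power_int_minus field_simps flip: of_nat_add)
    then show ?thesis
      using qpoch_shift_flip[of q q m j] q_nonzero by simp
  qed
  then have "poch q n = poch q m * (qsign q j * q ^ (m * j) * q ^ j * poch (q powi (- int n)) j)"
    using qpoch_add[of q q m j] by (simp add: assms add.commute)
  then show ?thesis
    using poch_q_nonzero q_nonzero qsign_nonzero[OF q_nonzero] by (simp add: qbinom_def assms)
qed

lemma qhyp_eq_cleared_phi:
  assumes "poch x n \<noteq> 0" "poch y n \<noteq> 0" "poch (q / q ^ n / g) n \<noteq> 0" "g \<noteq> 0"
  shows "poch x n * poch y n * poch g n * qhyp n q [c, d, h] [x, y, q / q ^ n / g] q = cleared_phi n c d h x y g"
  unfolding qhyp_def cleared_phi_def sum_distrib_left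
proof (rule sum.cong)
  fix j assume "j \<in> {..n}"
  then obtain m where m: "n = j + m"
    using le_Suc_ex by auto
  have x: "poch x n = poch x j * poch (x * q ^ j) m" and y: "poch y n = poch y j * poch (y * q ^ j) m"
    and v: "poch (q / q ^ n / g) n = poch (q / q ^ n / g) j * poch (q / q ^ n / g * q ^ j) m"
    unfolding m by (rule qpoch_add)+
  have "poch g n = poch g m * poch (g * q ^ m) j"
    unfolding m by (subst add.commute) (rule qpoch_add)
  then have g: "poch g n = poch g m * (qsign q j * q ^ (m * j) * g ^ j * poch (q / q ^ n / g) j)"
    using qpoch_shift_flip[of q g m j] q_nonzero assms(4) by (simp add: m)
  obtain X Y G where XYG: "X = poch x j" "Y = poch y j" "G = poch (q / q ^ n / g) j"
    by blast
  have nz: "X \<noteq> 0" "Y \<noteq> 0" "G \<noteq> 0" "qsign q j * q ^ (m * j) * q ^ j \<noteq> 0"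
    using assms(1-3) x y v q_nonzero qsign_nonzero[OF q_nonzero] XYG by auto
  have "poch x n * poch y n * poch g n *
      (qpochs (q powi (- int n) # [c, d, h]) q j / qpochs (q # [x, y, q / q ^ n / g]) q j * q ^ j)
    = (X * poch (x * q ^ j) m) * (Y * poch (y * q ^ j) m) * (poch g m * (qsign q j * q ^ (m * j) * g ^ j * G))
      * (qpoch (q powi (- int n)) q j / poch q j * (poch c j * poch d j * poch h j) / (X * Y * G) * q ^ j)"
    unfolding x y g XYG by simp
  also have "\<dots> = qbinom n j * g ^ j * poch c j * poch d j * poch h j
        * poch (x * q ^ j) m * poch (y * q ^ j) m * poch g m"
    unfolding qpoch_negative_power[OF m] using nz q_nonzero by (simp add: field_simps)
  finally show "poch x n * poch y n * poch g n *
      (qpochs (q powi (- int n) # [c, d, h]) q j / qpochs (q # [x, y, q / q ^ n / g]) q j * q ^ j)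
    = qbinom n j * g ^ j * poch c j * poch d j * poch h j
        * poch (x * q ^ j) (n - j) * poch (y * q ^ j) (n - j) * poch g (n - j)"
    by (simp add: m)
qed simp

lemma W87_eq_cleared_W:
  assumes "s\<^sup>2 = b" "admissible n q (W_lower n q b s [c, d, e, f])" "b \<noteq> 1"
    and b: "\<And>i. i \<le> 2 * n \<Longrightarrow> b * q ^ i \<noteq> 1" and "c \<noteq> 0" "d \<noteq> 0" "e \<noteq> 0" "f \<noteq> 0"
    and z: "z = q ^ (n + 2) * b\<^sup>2 / (c * d * e * f)"
  shows "poch (q * b / c) n * poch (q * b / d) n * poch (q * b / e) n * poch (q * b / f) n * W87 n q b s [c, d, e, f] z
       = poch (q * b) n * cleared_W n b c d e f"
  unfolding W87_def qhyp_def cleared_W_def sum_distrib_left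
proof (rule sum.cong)
  fix k assume "k \<in> {..n}"
  then obtain m where m: "n = k + m"
    using le_Suc_ex by auto
  have "\<forall>x\<in>set (W_lower n q b s [c, d, e, f]). poch x n \<noteq> 0"
    using assms(2) by (simp add: admissible_iff_qpoch q_nonzero)
  then have "\<forall>x\<in>set (W_lower n q b s [c, d, e, f]). poch x k \<noteq> 0"
    unfolding m qpoch_add by simp
  then have nz: "poch s k \<noteq> 0" "poch (- s) k \<noteq> 0" "poch (q ^ (n + 1) * b) k \<noteq> 0"
      "poch (q * b / c) k \<noteq> 0" "poch (q * b / d) k \<noteq> 0" "poch (q * b / e) k \<noteq> 0" "poch (q * b / f) k \<noteq> 0"
    by (simp_all add: W_lower_def)
  have nzb: "poch (b * q ^ k) (Suc n) \<noteq> 0"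
    using b by (auto simp: qpoch_eq_0_iff mult.assoc m simp flip: power_add)
  have root: "(1 - t) * poch (q * t) k = poch t k * (1 - t * q ^ k)" for t
    using qpoch_Suc[of t q k] qpoch_Suc_shift[of t q k] by (simp add: mult.commute)
  have "(1 - b) * (poch (q * s) k * poch (- (q * s)) k)
      = ((1 - s) * poch (q * s) k) * ((1 - - s) * poch (q * - s) k)"
    by (simp add: assms(1)[symmetric] power2_eq_square algebra_simps)
  also have "\<dots> = poch s k * poch (- s) k * (1 - b * q ^ (2 * k))"
    unfolding root mult_2 power_add by (simp add: assms(1)[symmetric] power2_eq_square algebra_simps)
  finally have sq: "poch (q * s) k * poch (- (q * s)) k / (poch s k * poch (- s) k) = (1 - b * q ^ (2 * k)) / (1 - b)"
    using nz \<open>b \<noteq> 1\<close> by (simp add: divide_simps mult.commute)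
  have "poch b k * poch (b * q ^ k) (Suc n) = (1 - b) * poch (q * b) n * poch (q ^ (n + 1) * b) k"
    using qpoch_add[of b q k "Suc n"] qpoch_add[of b q "Suc n" k] qpoch_Suc_shift[of b q n]
    by (simp add: add.commute mult_ac)
  then have bb: "poch b k / (1 - b) / poch (q ^ (n + 1) * b) k = poch (q * b) n / poch (b * q ^ k) (Suc n)"
    using nz nzb \<open>b \<noteq> 1\<close> by (simp add: divide_simps mult_ac)
  have tail: "poch (q * b / t) n = poch (q * b / t) k * poch (b / t * q ^ Suc k) (n - k)" for t
    using qpoch_add[of "q * b / t" q k m] by (simp add: m mult_ac)
  have "qsign q k * q ^ k * qsign q k * q ^ (m * k) = q ^ (n * k)"
    using qsign_square[of q k] by (simp add: m ring_distribs power_add mult_ac)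
  then have sgn: "1 / (qsign q k * q ^ (m * k) * q ^ k) = qsign q k / q ^ (n * k)"
    using q_nonzero qsign_nonzero[OF q_nonzero, of k] by (simp add: divide_simps mult_ac)
  have zk: "z ^ k = q ^ (n * k) * (q ^ (2 * k) * (b\<^sup>2 / (c * d * e * f)) ^ k)"
  proof -
    have "(q ^ (n + 2)) ^ k = q ^ (n * k) * q ^ (2 * k)"
      by (simp only: power_mult power_add power_mult_distrib)
    then show ?thesis
      unfolding z times_divide_eq_right[symmetric] power_mult_distrib by (simp only: mult.assoc)
  qed
  define T where "T t = poch t k * poch (b / t * q ^ Suc k) (n - k)" for t
  have num: "poch (q * b / t) n * (poch t k / poch (q * b / t) k) = T t" if "poch (q * b / t) k \<noteq> 0" for t
    using that unfolding tail T_def by simp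
  have "poch (q * b / c) n * poch (q * b / d) n * poch (q * b / e) n * poch (q * b / f) n
      * (qpochs (q powi (- int n) # W_upper q b s [c, d, e, f]) q k
         / qpochs (q # W_lower n q b s [c, d, e, f]) q k * z ^ k)
    = (qpoch (q powi (- int n)) q k / poch q k)
      * (poch b k / poch (q ^ (n + 1) * b) k)
      * (poch (q * s) k * poch (- (q * s)) k / (poch s k * poch (- s) k))
      * (poch (q * b / c) n * (poch c k / poch (q * b / c) k)) * (poch (q * b / d) n * (poch d k / poch (q * b / d) k))
      * (poch (q * b / e) n * (poch e k / poch (q * b / e) k)) * (poch (q * b / f) n * (poch f k / poch (q * b / f) k))
      * z ^ k"
    by (simp add: W_upper_def W_lower_def mult_ac)
  also have "\<dots> = qbinom n k * (1 / (qsign q k * q ^ (m * k) * q ^ k))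
      * (poch b k / (1 - b) / poch (q ^ (n + 1) * b) k) * (1 - b * q ^ (2 * k))
      * T c * T d * T e * T f * z ^ k"
    unfolding num[OF nz(4)] num[OF nz(5)] num[OF nz(6)] num[OF nz(7)] sq qpoch_negative_power[OF m]
    by (simp add: mult_ac)
  also have "\<dots> = poch (q * b) n * (qbinom n k * (qsign q k * q ^ (2 * k)) * (b\<^sup>2 / (c * d * e * f)) ^ k
      * T c * T d * T e * T f * ((1 - b * q ^ (2 * k)) / poch (b * q ^ k) (Suc n)))"
    unfolding sgn bb zk using q_nonzero by (simp add: mult_ac)
  finally show "poch (q * b / c) n * poch (q * b / d) n * poch (q * b / e) n * poch (q * b / f) n
      * (qpochs (q powi (- int n) # W_upper q b s [c, d, e, f]) q k
         / qpochs (q # W_lower n q b s [c, d, e, f]) q k * z ^ k)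
    = poch (q * b) n * (qbinom n k * (qsign q k * q ^ (2 * k)) * (b\<^sup>2 / (c * d * e * f)) ^ k
        * (poch c k * poch (b / c * q ^ Suc k) (n - k)) * (poch d k * poch (b / d * q ^ Suc k) (n - k))
        * (poch e k * poch (b / e * q ^ Suc k) (n - k)) * (poch f k * poch (b / f * q ^ Suc k) (n - k))
        * ((1 - b * q ^ (2 * k)) / poch (b * q ^ k) (Suc n)))"
    unfolding T_def .
qed simp

text \<open>
  Watson's transformation needs \<open>b q^i \<noteq> 1\<close> for all \<open>i \<le> 2 n\<close>. Admissibility gives this for the even
  \<open>i < 2 n\<close>, through the denominators \<open>\<plusminus>\<surd>b\<close>, and for \<open>n < i \<le> 2 n\<close>, through \<open>q^(n+1) b\<close>; the
  remaining exponents are covered by \<open>(q b; q)_n \<noteq> 0\<close>. For \<open>n = 0\<close> both sides are \<open>1\<close>.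
\<close>
lemma W87_eq_cleared_phi:
  assumes "s\<^sup>2 = b" "admissible n q (W_lower n q b s [c, d, e, f])" "poch (q * b) n \<noteq> 0"
    and "b \<noteq> 0" "c \<noteq> 0" "d \<noteq> 0" "e \<noteq> 0" "f \<noteq> 0"
    and "z = q ^ (n + 2) * b\<^sup>2 / (c * d * e * f)"
  shows "poch (q * b / c) n * poch (q * b / d) n * poch (q * b / e) n * poch (q * b / f) n * W87 n q b s [c, d, e, f] z
       = poch (q * b) n * cleared_phi n c d (q * b / (e * f)) (q * b / e) (q * b / f) (q * b / (c * d))"
proof (cases "n = 0")
  case True
  then show ?thesis
    by (simp add: W87_def qhyp_def cleared_phi_def W_upper_def W_lower_def)
next
  case False
  have adm: "poch s n \<noteq> 0" "poch (- s) n \<noteq> 0" "poch (q ^ (n + 1) * b) n \<noteq> 0"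
    using assms(2) by (simp_all add: admissible_iff_qpoch q_nonzero W_lower_def)
  have b: "b * q ^ i \<noteq> 1" if i: "i \<le> 2 * n" for i
  proof
    assume *: "b * q ^ i = 1"
    have "even i \<and> i < 2 * n \<or> 1 \<le> i \<and> i \<le> n \<or> n + 1 \<le> i"
      using False by (cases "i = 0") auto
    then consider "even i" "i < 2 * n" | "1 \<le> i" "i \<le> n" | "n + 1 \<le> i"
      by blast
    then show False
    proof cases
      case 1
      then obtain k where k: "i = 2 * k" "k < n"
        by auto
      then have "(s * q ^ k)\<^sup>2 = 1"
        using * by (simp add: assms(1) power_mult_distrib mult.commute flip: power_mult)
      then have "s * q ^ k = 1 \<or> - s * q ^ k = 1"
        by (auto simp: power2_eq_1_iff)
      then show False
        using adm(1,2) k by (auto simp: qpoch_eq_0_iff)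
    next
      case 2
      then obtain k where "i = Suc k" "k < n"
        by (cases i) auto
      then show False
        using assms(3) * by (auto simp: qpoch_eq_0_iff mult_ac)
    next
      case 3
      then obtain k where "i = n + 1 + k"
        using le_Suc_ex by blast
      then show False
        using adm(3) * i by (auto simp: qpoch_eq_0_iff mult_ac power_add)
    qed
  qed
  then have "b \<noteq> 1"
    by force
  then show ?thesis
    using W87_eq_cleared_W[OF assms(1,2) _ b assms(5-9)] watson[OF b assms(4-8)] by simp
qed

text \<open>
  A form with all arguments as variables, so that a concrete instance leaves only rational
  identities between parameters to be checked.
\<close>
lemma W87_watson:
  assumes "s\<^sup>2 = b" "admissible n q (W_lower n q b s [c, d, e, f])" "poch B n \<noteq> 0"
    and "b \<noteq> 0" "c \<noteq> 0" "d \<noteq> 0" "e \<noteq> 0" "f \<noteq> 0"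
    and "q ^ (n + 2) * b\<^sup>2 / (c * d * e * f) = z"
    and "q * b = B" "q * b / c = c'" "q * b / d = d'" "q * b / e = e'" "q * b / f = f'"
    and "q * b / (e * f) = h" "q * b / (c * d) = g"
  shows "poch c' n * poch d' n * poch e' n * poch f' n * W87 n q b s [c, d, e, f] z
       = poch B n * cleared_phi n c d h e' f' g"
  using W87_eq_cleared_phi[of s b n c d e f z] assms by auto

end

section \<open>The Askey--Wilson polynomial\<close>

text \<open>
  Here \<open>a\<close> is the distinguished parameter \<open>a_p\<close>, the numbers \<open>b\<close>, \<open>c\<close>, \<open>d\<close> are the other three in
  any order, \<open>v = q^(1-n)\<close>, and \<open>E\<close>, \<open>F\<close> stand for \<open>e^(i\<theta>)\<close> and \<open>e^(-i\<theta>)\<close>. These data are stable under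
  permutations of \<open>b, c, d\<close> and under the exchange of \<open>E\<close> and \<open>F\<close>, and neither changes the value of
  the polynomial; further interpretations of the locale exploit this symmetry.
\<close>
locale askey_wilson_parameters = not_root_of_unity +
  fixes n :: nat and v a b c d A E F :: complex
  assumes v_eq: "v = q / q ^ n" and nonzero: "a \<noteq> 0" "b \<noteq> 0" "c \<noteq> 0" "d \<noteq> 0"
    and A_eq: "A = a * b * c * d" and EF: "E * F = 1"
    and admissible: "poch (a * b) n \<noteq> 0" "poch (a * c) n \<noteq> 0" "poch (a * d) n \<noteq> 0"
begin

definition aw :: complex where
  "aw = 1 / a ^ n * (poch (a * b) n * poch (a * c) n * poch (a * d) n)
      * qhyp n q [1 / v * A, a * E, a * F] [a * b, a * c, a * d] q"

lemma E_nonzero: "E \<noteq> 0" and v_nonzero: "v \<noteq> 0" and A_nonzero: "A \<noteq> 0"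
  using EF q_nonzero nonzero by (auto simp: v_eq A_eq)

lemma F_eq: "F = 1 / E"
  using EF E_nonzero by (simp add: eq_divide_eq mult.commute)

lemmas nz = E_nonzero v_nonzero A_nonzero nonzero q_nonzero

lemma F_nonzero: "F \<noteq> 0"
  using EF by auto

abbreviation K :: complex where "K \<equiv> qsign q n"

lemma K_nonzero: "K \<noteq> 0"
  by (rule qsign_nonzero[OF q_nonzero])

lemma K_square: "K ^ 2 * v ^ n = 1"
  unfolding v_eq by (rule qsign_square_eq)

lemma qpoch_n_flip: "x \<noteq> 0 \<Longrightarrow> poch x n = K * x ^ n * poch (v / x) n"
  using qpoch_flip[of q x n] q_nonzero by (simp add: v_eq)

lemma power_cancel: "E ^ n * F ^ n = 1"
  by (simp add: EF flip: power_mult_distrib)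

text \<open>
  The first normal form. Of the three denominator parameters it is \<open>a d\<close> that is encoded by \<open>g\<close>;
  rewriting \<open>(a d; q)_n\<close> by its reciprocal argument explains the prefactor.
\<close>
lemma aw_eq_phi:
  "aw = K * d ^ n * cleared_phi n (A / v) (a * E) (a * F) (a * b) (a * c) (v / (a * d))"
proof -
  have e: "q / q ^ n / (v / (a * d)) = a * d"
    using nz by (simp add: v_eq)
  have "poch (a * b) n * poch (a * c) n * poch (v / (a * d)) n
      * qhyp n q [1 / v * A, a * E, a * F] [a * b, a * c, a * d] q
      = cleared_phi n (1 / v * A) (a * E) (a * F) (a * b) (a * c) (v / (a * d))"
    using qhyp_eq_cleared_phi[of "a * b" n "a * c" "v / (a * d)" "1 / v * A" "a * E" "a * F"] admissible nz
    unfolding e by simp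
  moreover have "poch (a * d) n = K * (a * d) ^ n * poch (v / (a * d)) n"
    by (rule qpoch_n_flip) (use nz in simp)
  ultimately show ?thesis
    unfolding aw_def using nz by (simp add: power_mult_distrib field_simps)
qed

text \<open>
  The second normal form: in Sears' transformation the numerator parameter \<open>a E\<close> and the denominator
  parameter \<open>a b\<close> stay fixed.
\<close>
lemma aw_eq_sears:
  "aw = K * d ^ n * cleared_phi n (a * E) (b * E) (v / (c * d)) (a * b) (v * E / d) (c * F)"
proof -
  define w where "w = a * c * d * F / v"
  have e: "b * E * w = A / v" "v / (c * d) * w = a * F" "b * E * (v / (c * d)) * w = a * b"
      "a * E * (v / (a * d)) * w = a * c" "a * E * (v / (a * d)) = v * E / d" "v / (a * d) * w = c * F"
    using nz by (simp_all add: w_def F_eq A_eq)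
  show ?thesis
    unfolding aw_eq_phi using sears[of n "a * E" "b * E" w "v / (c * d)" "v / (a * d)"]
    unfolding e(1-4) unfolding e(5,6) by (simp add: cleared_phi_def mult_ac)
qed

text \<open>
  The second normal form with \<open>a b\<close> as distinguished denominator parameter, the shape in which
  Watson's transformation delivers it.
\<close>
lemma aw_eq_exchanged:
  "aw = K ^ 3 * (A * F) ^ n * cleared_phi n (a * E) (b * E) (v / (c * d)) (v * E / c) (v * E / d) (v / (a * b))"
proof -
  have e: "q / q ^ n / (v / (a * b)) = a * b" "q / q ^ n / (v * E / c) = c * F"
      "v / (a * b) * (v * E / c) / (q / q ^ n) = v * E / (a * b * c)"
    using nz by (simp_all add: F_eq v_eq)
  have "cleared_phi n (a * E) (b * E) (v / (c * d)) (v * E / d) (v * E / c) (v / (a * b))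
      = (v * E / (a * b * c)) ^ n * cleared_phi n (a * E) (b * E) (v / (c * d)) (v * E / d) (a * b) (c * F)"
    using cleared_phi_exchange[of "v * E / d" "v * E / c" "a * E" "b * E" "v / (c * d)" "v / (a * b)" n] nz
    unfolding e by (simp add: field_simps)
  then have "K ^ 3 * (A * F) ^ n * cleared_phi n (a * E) (b * E) (v / (c * d)) (v * E / d) (v * E / c) (v / (a * b))
      = K * (K ^ 2 * ((A * F) * (v * E / (a * b * c))) ^ n)
        * cleared_phi n (a * E) (b * E) (v / (c * d)) (v * E / d) (a * b) (c * F)"
    by (simp only: power_mult_distrib power2_eq_square power3_eq_cube mult_ac)
  also have "(A * F) * (v * E / (a * b * c)) = d * v"
    using nz by (simp add: F_eq A_eq)
  also have "K ^ 2 * (d * v) ^ n = (K ^ 2 * v ^ n) * d ^ n"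
    by (simp add: power_mult_distrib mult_ac)
  finally show ?thesis
    unfolding aw_eq_sears K_square by (simp add: cleared_phi_perm mult_ac)
qed

text \<open>
  The first normal form is reversed, with \<open>a E\<close> as the numerator parameter that trades places with the
  hidden denominator parameter \<open>v/(a d)\<close>.
\<close>
lemma aw_reversed_4phi3:
  assumes "poch (A / q) n \<noteq> 0" "poch (v\<^sup>2 / A) n \<noteq> 0" "poch (v * E / a) n \<noteq> 0" "poch (v * F / a) n \<noteq> 0"
  shows "aw = 1 / (K * a ^ n) * (poch (A / q) (2 * n) * (poch (a * E) n * poch (a * F) n) / poch (A / q) n)
      * qhyp n q [v / (a * b), v / (a * c), v / (a * d)] [v\<^sup>2 / A, v * E / a, v * F / a] q"
    (is "_ = _ * _ * ?Q")
proof -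
  have e: "v / (A / v) = v\<^sup>2 / A" "v / (a * F) = v * E / a" "q / q ^ n / (a * E) = v * F / a"
      "A / q * q ^ n = A / v" "v / (a * d) * (A / v) * (a * F) = A * F / d"
    using nz by (simp_all add: F_eq v_eq power2_eq_square)
  have "cleared_phi n (a * E) (A / v) (a * F) (a * b) (a * c) (v / (a * d))
      = K ^ 2 * (v / (a * d) * (A / v) * (a * F)) ^ n * cleared_phi n (v / (a * d)) (v / (a * b)) (v / (a * c))
        (v / (A / v)) (v / (a * F)) (a * E)"
    unfolding v_eq by (rule cleared_phi_reverse) (use nz in \<open>auto simp: F_eq A_eq field_simps\<close>)
  also have "cleared_phi n (v / (a * d)) (v / (a * b)) (v / (a * c)) (v / (A / v)) (v / (a * F)) (a * E)
      = poch (v\<^sup>2 / A) n * poch (v * E / a) n * poch (a * E) n * ?Q"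
    using qhyp_eq_cleared_phi[of "v\<^sup>2 / A" n "v * E / a" "a * E" "v / (a * b)" "v / (a * c)" "v / (a * d)"]
      assms nz unfolding e by (simp add: cleared_phi_def mult_ac)
  finally have aw: "aw = K ^ 3 * d ^ n * (A * F / d) ^ n * (poch (v\<^sup>2 / A) n * poch (v * E / a) n * poch (a * E) n * ?Q)"
    unfolding aw_eq_phi e by (simp add: cleared_phi_perm power3_eq_cube power2_eq_square)
  have r: "poch (A / q) (2 * n) / poch (A / q) n = K * (A / v) ^ n * poch (v\<^sup>2 / A) n"
    using qpoch_add[of "A / q" q n n] qpoch_n_flip[of "A / v"] assms(1) nz unfolding e by (simp add: mult_2)
  have f: "poch (a * F) n = K * (a * F) ^ n * poch (v * E / a) n"
    using qpoch_n_flip[of "a * F"] nz F_nonzero unfolding e by simp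
  have k: "K ^ 3 * d ^ n * (A * F / d) ^ n = 1 / (K * a ^ n) * (K * (A / v) ^ n) * (K * (a * F) ^ n)"
  proof -
    have base: "d * (A * F / d) = v * (A * F / v)" "A / v * (a * F) = a * (A * F / v)"
      using nz by simp_all
    have "K ^ 3 * d ^ n * (A * F / d) ^ n = K * (K ^ 2 * (d * (A * F / d)) ^ n)"
      by (simp only: power_mult_distrib power2_eq_square power3_eq_cube mult_ac)
    also have "\<dots> = K * ((K ^ 2 * v ^ n) * (A * F / v) ^ n)"
      unfolding base by (simp only: power_mult_distrib mult_ac)
    also have "\<dots> = 1 / (K * a ^ n) * (K * K) * (A / v * (a * F)) ^ n"
      unfolding base K_square power_mult_distrib using nz K_nonzero by simp
    finally show ?thesis
      by (simp only: power_mult_distrib mult_ac)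
  qed
  have "1 / (K * a ^ n) * (poch (A / q) (2 * n) * (poch (a * E) n * poch (a * F) n) / poch (A / q) n) * ?Q
      = 1 / (K * a ^ n) * (poch (A / q) (2 * n) / poch (A / q) n) * (poch (a * E) n * poch (a * F) n) * ?Q"
    by simp
  also have "\<dots> = aw"
    unfolding r f aw k by (simp only: mult_ac)
  finally show ?thesis ..
qed

lemma aw_sears_4phi3:
  assumes "poch (v * E / c) n \<noteq> 0" "poch (v * E / d) n \<noteq> 0"
  shows "aw = E ^ n * (poch (a * b) n * poch (c * F) n * poch (d * F) n)
      * qhyp n q [a * E, b * E, v / (c * d)] [a * b, v * E / c, v * E / d] q"
    (is "_ = _ * _ * ?Q")
proof -
  have e: "q / q ^ n / (c * F) = v * E / c" "v / (d * F) = v * E / d"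
    using nz by (simp_all add: F_eq v_eq)
  have "?Q = qhyp n q [a * E, b * E, v / (c * d)] [a * b, v * E / d, v * E / c] q"
    by (rule qhyp_mset) simp_all
  then have phi: "poch (a * b) n * poch (v * E / d) n * poch (c * F) n * ?Q
      = cleared_phi n (a * E) (b * E) (v / (c * d)) (a * b) (v * E / d) (c * F)"
    using qhyp_eq_cleared_phi[of "a * b" n "v * E / d" "c * F" "a * E" "b * E" "v / (c * d)"]
      assms admissible nz F_nonzero unfolding e by simp
  have dF: "poch (d * F) n = K * (d * F) ^ n * poch (v * E / d) n"
    using qpoch_n_flip[of "d * F"] nz F_nonzero unfolding e by simp
  have pw: "E ^ n * (d * F) ^ n = d ^ n"
    using power_cancel by (simp add: power_mult_distrib mult_ac)
  show ?thesis
    unfolding aw_eq_sears phi[symmetric] dF pw[symmetric] by (simp only: mult_ac)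
qed

text \<open>
  The common last step for the \<open>8W7\<close> representations: \<open>P\<close> is the cleared \<open>4phi3\<close> and \<open>W\<close> the \<open>8W7\<close>,
  \<open>X\<close> and \<open>B\<close> are the shifted factorials in Watson's transformation, and the prefactor \<open>N / D\<close> of
  the claimed representation differs from \<open>X / B\<close> by powers \<open>l / k\<close> from reciprocal arguments.
\<close>
lemma aw_from_watson:
  assumes "aw = \<kappa> * P" "X * W = B * P" "B \<noteq> 0" "k \<noteq> 0" "N = l * X" "D = k * B" "\<kappa> * k = l"
  shows "aw = N / D * W"
proof -
  have "N / D * W = \<kappa> * (X * W) / B"
    using assms(4) by (simp add: assms(5,6) assms(7)[symmetric])
  then show ?thesis
    using assms(1-3) by simp
qed

lemma qpoch_F_flip: "t \<noteq> 0 \<Longrightarrow> poch (t * F) n = K * (t * F) ^ n * poch (v * E / t) n"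
  using qpoch_n_flip[of "t * F"] E_nonzero F_nonzero by (simp add: F_eq)

text \<open>
  With base parameter \<open>q^-n E^2\<close>, the pairing \<open>{a E, b E}\<close>, \<open>{c E, d E}\<close> in Watson's transformation
  leads to the second normal form.
\<close>
lemma aw_W87_symmetric:
  assumes \<beta>: "\<beta> = 1 / q ^ n * E\<^sup>2" "s\<^sup>2 = \<beta>" and "poch (F\<^sup>2) n \<noteq> 0"
    and adm: "admissible n q (W_lower n q \<beta> s [a * E, b * E, c * E, d * E])"
  shows "aw = E ^ n * (poch (a * F) n * poch (b * F) n * poch (c * F) n * poch (d * F) n / poch (F\<^sup>2) n)
      * W87 n q \<beta> s [a * E, b * E, c * E, d * E] (q * v / A)"
proof -
  have F2: "poch (F\<^sup>2) n = K * (F\<^sup>2) ^ n * poch (v * E\<^sup>2) n"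
    using qpoch_n_flip[of "F\<^sup>2"] E_nonzero F_nonzero by (simp add: F_eq power2_eq_square)
  then have B: "poch (v * E\<^sup>2) n \<noteq> 0"
    using assms(3) by auto
  have W: "poch (v * E / a) n * poch (v * E / b) n * poch (v * E / c) n * poch (v * E / d) n
      * W87 n q \<beta> s [a * E, b * E, c * E, d * E] (q * v / A)
      = poch (v * E\<^sup>2) n * cleared_phi n (a * E) (b * E) (v / (c * d)) (v * E / c) (v * E / d) (v / (a * b))"
    by (rule W87_watson[OF \<beta>(2) adm B])
      (use nz in \<open>simp_all add: \<beta>(1) A_eq v_eq power2_eq_square power_add\<close>)
  have "(A * F) * F\<^sup>2 = E * (a * F) * (b * F) * (c * F) * (d * F)"
    using nz by (simp add: A_eq F_eq power2_eq_square)
  then have pw: "(A * F) ^ n * (F\<^sup>2) ^ n = E ^ n * (a * F) ^ n * (b * F) ^ n * (c * F) ^ n * (d * F) ^ n"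
    by (simp only: power_mult_distrib[symmetric])
  have "aw = E ^ n * (poch (a * F) n * poch (b * F) n * poch (c * F) n * poch (d * F) n) / poch (F\<^sup>2) n
      * W87 n q \<beta> s [a * E, b * E, c * E, d * E] (q * v / A)"
  proof (rule aw_from_watson[OF aw_eq_exchanged W B _ _ F2])
    show "E ^ n * (poch (a * F) n * poch (b * F) n * poch (c * F) n * poch (d * F) n)
        = K ^ 4 * ((A * F) ^ n * (F\<^sup>2) ^ n)
          * (poch (v * E / a) n * poch (v * E / b) n * poch (v * E / c) n * poch (v * E / d) n)"
      unfolding pw qpoch_F_flip[OF nonzero(1)] qpoch_F_flip[OF nonzero(2)] qpoch_F_flip[OF nonzero(3)] qpoch_F_flip[OF nonzero(4)]
        power4_eq_xxxx by (simp only: mult_ac)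
  qed (use K_nonzero F_nonzero in \<open>simp_all add: eval_nat_numeral mult_ac\<close>)
  then show ?thesis
    by simp
qed

text \<open>
  Since \<open>v a b / A = v / (c d)\<close>, the pairing of \<open>a E\<close> with \<open>v a b / A\<close> leads to the same
  \<open>4phi3\<close> as for the symmetric \<open>8W7\<close>. The quotients of shifted factorials of
  lengths \<open>2 n\<close> and \<open>n\<close> are shifted factorials with argument multiplied by \<open>q^n\<close>.
\<close>
lemma aw_W87_reversed:
  assumes \<beta>: "\<beta> = v / q ^ n * a * E / A" "s\<^sup>2 = \<beta>"
    and "poch (A / q) n \<noteq> 0" "poch (A * F / (q * a)) (2 * n) \<noteq> 0"
    and "admissible n q (W_lower n q \<beta> s [v * (a * b) / A, v * (a * c) / A, v * (a * d) / A, a * E])"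
  shows "aw = E ^ n * (poch (A / q) (2 * n) * (poch (b * F) n * poch (c * F) n * poch (d * F) n * poch (A * F / (q * a)) n)
        / (poch (A / q) n * poch (A * F / (q * a)) (2 * n)))
      * W87 n q \<beta> s [v * (a * b) / A, v * (a * c) / A, v * (a * d) / A, a * E] (q * E / a)"
    (is "_ = _ * _ * ?W")
proof -
  let ?cs = "[a * E, v * (a * b) / A, v * (a * c) / A, v * (a * d) / A]"
  have perm: "?W = W87 n q \<beta> s ?cs (q * E / a)"
    by (rule W87_mset) simp
  have adm: "admissible n q (W_lower n q \<beta> s ?cs)"
    using assms(5) by (auto simp: admissible_def W_lower_def)
  have num: "poch (A / q) (2 * n) = poch (A / q) n * (K * (A / v) ^ n * poch (v\<^sup>2 / A) n)"
  proof -
    have e: "A / q * q ^ n = A / v" "v / (A / v) = v\<^sup>2 / A"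
      using nz by (simp_all add: v_eq power2_eq_square)
    show ?thesis
      using qpoch_add[of "A / q" q n n] qpoch_n_flip[of "A / v"] nz unfolding e by (simp add: mult_2)
  qed
  define B where "B = v\<^sup>2 * a * E / A"
  have "poch (A * F / (v * a)) n = K * (A * F / (v * a)) ^ n * poch B n"
  proof -
    have "v / (A * F / (v * a)) = B"
      using nz by (simp add: F_eq B_def power2_eq_square)
    then show ?thesis
      using qpoch_n_flip[of "A * F / (v * a)"] nz F_nonzero by simp
  qed
  then have den: "poch (A * F / (q * a)) (2 * n)
      = poch (A * F / (q * a)) n * (K * (A * F / (v * a)) ^ n * poch B n)"
    using qpoch_add[of "A * F / (q * a)" q n n] nz by (simp add: mult_2 v_eq)
  then have B: "poch B n \<noteq> 0" and p0: "poch (A * F / (q * a)) n \<noteq> 0"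
    using assms(4) by auto
  have W: "poch (v\<^sup>2 / A) n * poch (v * E / b) n * poch (v * E / c) n * poch (v * E / d) n * ?W
      = poch B n * cleared_phi n (a * E) (v / (c * d)) (b * E) (v * E / c) (v * E / d) (v / (a * b))"
  proof -
    have cd: "v / (c * d) = v * (a * b) / A"
      using nz by (simp add: A_eq)
    show ?thesis
      unfolding perm cd by (rule W87_watson[OF \<beta>(2) adm B])
        (use nz in \<open>simp_all add: \<beta>(1) A_eq v_eq B_def power2_eq_square power_add\<close>)
  qed
  have "(A * F) * (A * F / (v * a)) = E * (A / v) * (b * F) * (c * F) * (d * F)"
    using nz by (simp add: A_eq F_eq mult_ac)
  then have pw: "(A * F) ^ n * (A * F / (v * a)) ^ n = E ^ n * (A / v) ^ n * (b * F) ^ n * (c * F) ^ n * (d * F) ^ n"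
    by (simp only: power_mult_distrib[symmetric])
  have "aw = E ^ n * ((K * (A / v) ^ n * poch (v\<^sup>2 / A) n) * (poch (b * F) n * poch (c * F) n * poch (d * F) n))
      / (K * (A * F / (v * a)) ^ n * poch B n) * ?W"
  proof (rule aw_from_watson[OF _ W B _ _ refl])
    show "aw = K ^ 3 * (A * F) ^ n
        * cleared_phi n (a * E) (v / (c * d)) (b * E) (v * E / c) (v * E / d) (v / (a * b))"
      unfolding aw_eq_exchanged by (simp add: cleared_phi_perm)
    show "E ^ n * ((K * (A / v) ^ n * poch (v\<^sup>2 / A) n) * (poch (b * F) n * poch (c * F) n * poch (d * F) n))
        = K ^ 4 * ((A * F) ^ n * (A * F / (v * a)) ^ n)
          * (poch (v\<^sup>2 / A) n * poch (v * E / b) n * poch (v * E / c) n * poch (v * E / d) n)"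
      unfolding pw qpoch_F_flip[OF nonzero(2)] qpoch_F_flip[OF nonzero(3)] qpoch_F_flip[OF nonzero(4)]
        power4_eq_xxxx by (simp only: mult_ac)
  qed (use K_nonzero F_nonzero nz in \<open>simp_all add: eval_nat_numeral mult_ac\<close>)
  then show ?thesis
    unfolding num den using assms(3) p0 by simp
qed

text \<open>
  Pairing \<open>b E\<close> with \<open>c E\<close> gives the balanced series with numerator parameters \<open>b E\<close>, \<open>c E\<close>, \<open>v/(a d)\<close>.
  Its reversal is the second normal form with \<open>E\<close> and \<open>F\<close> exchanged and with the parameters in the
  order \<open>a, d, b, c\<close>.
\<close>
lemma aw_W87_forward:
  assumes \<beta>: "\<beta> = A * E / (q * a)" "s\<^sup>2 = \<beta>" and B: "poch (A * E / a) n \<noteq> 0"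
    and adm: "admissible n q (W_lower n q \<beta> s [b * E, c * E, d * E, 1 / v * A])"
  shows "aw = E ^ n * (poch (a * F) n * (poch (A / (a * b)) n * poch (A / (a * c)) n * poch (A / (a * d)) n)
        / poch (A * E / a) n) * W87 n q \<beta> s [b * E, c * E, d * E, 1 / v * A] (q * F / a)"
    (is "_ = _ * _ * ?W")
proof -
  interpret swapped: askey_wilson_parameters q n v a d b c A F E
    by unfold_locales (use v_eq nonzero A_eq EF admissible in \<open>simp_all add: mult_ac\<close>)
  have sw: "swapped.aw = aw"
    unfolding swapped.aw_def aw_def
    using qhyp_mset[of "[1 / v * A, a * F, a * E]" "[1 / v * A, a * E, a * F]"
        "[a * d, a * b, a * c]" "[a * b, a * c, a * d]" n q q] by (simp add: mult_ac)
  let ?P = "cleared_phi n (b * E) (c * E) (v / (a * d)) (A / (a * d)) (v * E / a) (d * F)"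
  have W: "poch (A / (a * b)) n * poch (A / (a * c)) n * poch (A / (a * d)) n * poch (v * E / a) n * ?W
      = poch (A * E / a) n * ?P"
    by (rule W87_watson[OF \<beta>(2) adm B])
      (use nz in \<open>simp_all add: \<beta>(1) A_eq v_eq F_eq power2_eq_square power_add\<close>)
  \<comment> \<open>Here \<open>b E\<close> trades places with \<open>d F\<close>, so that \<open>a\<close> enters through the numerator parameter \<open>a F\<close>.\<close>
  have "?P = K ^ 2 * (d * F * (c * E) * (v / (a * d))) ^ n
      * cleared_phi n (d * F) (v / (A / (a * d))) (v / (v * E / a)) (v / (c * E)) (v / (v / (a * d))) (b * E)"
    unfolding v_eq by (rule cleared_phi_reverse) (use nz in \<open>auto simp: F_eq A_eq field_simps\<close>)
  also have "v / (A / (a * d)) = v / (b * c)"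
    using nz by (simp add: A_eq)
  also have "v / (v * E / a) = a * F"
    using nz by (simp add: F_eq)
  also have "v / (c * E) = v * F / c"
    using nz by (simp add: F_eq)
  also have "v / (v / (a * d)) = a * d"
    using nz by simp
  also have "d * F * (c * E) * (v / (a * d)) = v * (c / a)"
    using nz by (simp add: F_eq)
  also have "K ^ 2 * (v * (c / a)) ^ n = (c / a) ^ n"
    unfolding power_mult_distrib using K_square by (simp flip: mult.assoc)
  finally have "a ^ n * ?P = c ^ n * cleared_phi n (d * F) (v / (b * c)) (a * F) (v * F / c) (a * d) (b * E)"
    using nz by (simp add: power_divide)
  then have aw: "aw = K * a ^ n * ?P"
    unfolding sw[symmetric] swapped.aw_eq_sears by (simp add: cleared_phi_def mult_ac)
  have "aw = E ^ n * (poch (a * F) n * (poch (A / (a * b)) n * poch (A / (a * c)) n * poch (A / (a * d)) n))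
        / poch (A * E / a) n * ?W"
  proof (rule aw_from_watson[OF aw W B, of 1])
    have "E ^ n * (a * F) ^ n = a ^ n"
      using power_cancel by (simp add: power_mult_distrib mult_ac)
    then have "E ^ n * poch (a * F) n = K * a ^ n * poch (v * E / a) n"
      using qpoch_F_flip[OF nonzero(1)] by (simp add: mult_ac)
    then show "E ^ n * (poch (a * F) n * (poch (A / (a * b)) n * poch (A / (a * c)) n * poch (A / (a * d)) n))
        = K * a ^ n * (poch (A / (a * b)) n * poch (A / (a * c)) n * poch (A / (a * d)) n * poch (v * E / a) n)"
      by (simp add: mult_ac)
  qed simp_all
  then show ?thesis
    by simp
qed

text \<open>
  Pairing \<open>a E\<close> with \<open>a F\<close> leads directly to the first normal form, with \<open>a b\<close> as the distinguished
  denominator parameter.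
\<close>
lemma aw_W87_two_parameters:
  assumes \<beta>: "\<beta> = 1 / q ^ n * a / b" "s\<^sup>2 = \<beta>" and "poch (b / a) n \<noteq> 0"
    and "admissible n q (W_lower n q \<beta> s [v / (b * c), v / (b * d), a * E, a * F])"
  shows "aw = 1 / a ^ n * (poch (a * c) n * poch (a * d) n * poch (b * E) n * poch (b * F) n / poch (b / a) n)
      * W87 n q \<beta> s [v / (b * c), v / (b * d), a * E, a * F] (q ^ n * (c * d))"
    (is "_ = _ * _ * ?W")
proof -
  interpret swapped: askey_wilson_parameters q n v a c d b A E F
    by unfold_locales (use v_eq nonzero A_eq EF admissible in \<open>simp_all add: mult_ac\<close>)
  have sw: "swapped.aw = aw"
    unfolding swapped.aw_def aw_def
    using qhyp_mset[of "[1 / v * A, a * E, a * F]" "[1 / v * A, a * E, a * F]"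
        "[a * c, a * d, a * b]" "[a * b, a * c, a * d]" n q q] by (simp add: mult_ac)
  let ?cs = "[a * E, a * F, v / (b * c), v / (b * d)]"
  let ?P = "cleared_phi n (a * E) (a * F) (A / v) (a * c) (a * d) (v / (a * b))"
  have perm: "?W = W87 n q \<beta> s ?cs (q ^ n * (c * d))"
    by (rule W87_mset) simp
  have adm: "admissible n q (W_lower n q \<beta> s ?cs)"
    using assms(4) by (auto simp: admissible_def W_lower_def)
  have den: "poch (b / a) n = K * (b / a) ^ n * poch (v * a / b) n"
    using qpoch_n_flip[of "b / a"] nz by simp
  then have B: "poch (v * a / b) n \<noteq> 0"
    using assms(3) by auto
  have W: "poch (v * F / b) n * poch (v * E / b) n * poch (a * c) n * poch (a * d) n * ?W = poch (v * a / b) n * ?P"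
    unfolding perm by (rule W87_watson[OF \<beta>(2) adm B])
      (use nz in \<open>simp_all add: \<beta>(1) A_eq v_eq F_eq power2_eq_square power_add\<close>)
  have aw: "aw = K * b ^ n * ?P"
    unfolding sw[symmetric] swapped.aw_eq_phi by (simp add: cleared_phi_def mult_ac)
  have "aw = 1 / a ^ n * (poch (a * c) n * poch (a * d) n * poch (b * E) n * poch (b * F) n) / poch (b / a) n * ?W"
  proof (rule aw_from_watson[OF aw W B _ _ den])
    have "b * E * (b * F) = b * b"
      using nz by (simp add: F_eq)
    then have pw: "(b * E) ^ n * (b * F) ^ n = b ^ n * b ^ n"
      by (simp only: power_mult_distrib[symmetric])
    have bE: "poch (b * E) n = K * (b * E) ^ n * poch (v * F / b) n"
      using qpoch_n_flip[of "b * E"] nz by (simp add: F_eq mult.commute)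
    have "poch (b * E) n * poch (b * F) n = K * K * (b ^ n * b ^ n) * (poch (v * F / b) n * poch (v * E / b) n)"
      unfolding bE qpoch_F_flip[OF nonzero(2)] pw[symmetric] by (simp only: mult_ac)
    then show "1 / a ^ n * (poch (a * c) n * poch (a * d) n * poch (b * E) n * poch (b * F) n)
        = K * K * (b ^ n * b ^ n) / a ^ n * (poch (v * F / b) n * poch (v * E / b) n * poch (a * c) n * poch (a * d) n)"
      by (simp add: mult_ac)
  qed (use K_nonzero nz in \<open>simp_all add: power_divide mult_ac\<close>)
  then show ?thesis
    by simp
qed

end

section \<open>The representations\<close>

lemma four_indices:
  fixes p r t u :: nat
  assumes "{p, r, t, u} \<subseteq> {1, 2, 3, 4}" "distinct [p, r, t, u]"
  shows "{p, r, t, u} = {1, 2, 3, 4}"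
  by (rule card_subset_eq) (use assms in auto)

lemma mset_entries:
  assumes "{p, r, t, u} \<subseteq> {1, 2, 3, 4}" "distinct [p, r, t, u]"
  shows "mset (entries f) = mset [f p, f r, f t, f u]"
proof -
  have "mset [1, 2, 3, 4] = mset [p, r, t, u]"
    using four_indices[OF assms] assms(2) by (subst set_eq_iff_mset_eq_distinct[symmetric]) auto
  then have "image_mset f (mset [1, 2, 3, 4]) = image_mset f (mset [p, r, t, u])"
    by (rule arg_cong)
  then show ?thesis
    by (simp add: entries_def)
qed

lemma mset_entries_except:
  assumes "{p, r, t, u} \<subseteq> {1, 2, 3, 4}" "distinct [p, r, t, u]"
  shows "mset (entries_except p f) = mset [f r, f t, f u]"
proof -
  have "set (filter (\<lambda>s. s \<noteq> p) [1, 2, 3, 4]) = {1, 2, 3, 4} - {p}"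
    by auto
  also have "\<dots> = set [r, t, u]"
    unfolding four_indices[OF assms, symmetric] using assms(2) by auto
  finally have "mset (filter (\<lambda>s. s \<noteq> p) [1, 2, 3, 4]) = mset [r, t, u]"
    using assms(2) by (subst set_eq_iff_mset_eq_distinct[symmetric]) (simp_all only: distinct_filter, auto)
  then have "image_mset f (mset (filter (\<lambda>s. s \<noteq> p) [1, 2, 3, 4])) = image_mset f (mset [r, t, u])"
    by (rule arg_cong)
  then show ?thesis
    by (simp add: entries_except_def del: filter.simps)
qed

lemma admissible_mset: "mset bs = mset bs' \<Longrightarrow> admissible n q bs = admissible n q bs'"
  unfolding admissible_def by (drule mset_eq_setD) simp

lemma admissible_W_lower_mset:
  "mset cs = mset cs' \<Longrightarrow> admissible n q (W_lower n q b s cs) = admissible n q (W_lower n q b s cs')"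
  unfolding W_lower_def by (intro admissible_mset) simp

text \<open>
  The definition of the polynomial uses \<open>arccos x\<close>, which agrees with the given angle \<open>\<theta>\<close> only up to
  sign and multiples of \<open>2 \<pi>\<close>.
\<close>
lemma cis_arccos_cos:
  "cis (arccos (cos \<theta>)) = cis \<theta> \<and> cis (- arccos (cos \<theta>)) = cis (- \<theta>)
   \<or> cis (arccos (cos \<theta>)) = cis (- \<theta>) \<and> cis (- arccos (cos \<theta>)) = cis \<theta>"
proof -
  have c: "cos (arccos (cos \<theta>)) = cos \<theta>"
    by (rule cos_arccos) auto
  then have "(sin (arccos (cos \<theta>)))\<^sup>2 = (sin \<theta>)\<^sup>2"
    by (simp add: sin_squared_eq)
  then show ?thesis
    using c by (auto simp: power2_eq_iff complex_eq_iff)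
qed

lemma not_root_of_unity_if_norm:
  assumes "q \<noteq> 0" "norm q \<noteq> 1"
  shows "not_root_of_unity q"
proof
  show "q ^ i \<noteq> 1" if "i > 0" for i
  proof
    assume "q ^ i = 1"
    then have "norm q ^ i = 1"
      by (metis norm_one norm_power)
    then show False
      using assms(2) that power_eq_1_iff[of "norm q" i] by simp
  qed
qed (rule assms)

theorem theorem3p1:
  fixes n p r t u :: nat and q A :: complex and a :: "nat \<Rightarrow> complex" and x \<theta> :: real
  assumes "{p, r, t, u} \<subseteq> {1, 2, 3, 4}" and "distinct [p, r, t, u]"
    and "q \<noteq> 0" and "norm q \<noteq> 1"
    and "\<And>k. k \<in> {1, 2, 3, 4} \<Longrightarrow> a k \<noteq> 0"
    and "A = a 1 * a 2 * a 3 * a 4"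
    and "x = cos \<theta>"
    and "admissible n q (entries_except p (\<lambda>s. a p * a s))"
  shows
    "askey_wilson p n x a q =
       a p powi (- int n) * qpochs (entries_except p (\<lambda>s. a p * a s)) q n
       * qhyp n q [q powi (int n - 1) * A, a p * cis \<theta>, a p * cis (- \<theta>)]
           (entries_except p (\<lambda>s. a p * a s)) q
     \<and>
     (let bs = [q powi (2 - 2 * int n) / A,
                q powi (1 - int n) * cis \<theta> / a p, q powi (1 - int n) * cis (- \<theta>) / a p]
      in qpoch (A / q) q n \<noteq> 0 \<and> admissible n q bs \<longrightarrow>
         askey_wilson p n x a q =
           q powi (- int (n choose 2)) * (- a p) powi (- int n)
           * (qpoch (A / q) q (2 * n) * qpochs [a p * cis \<theta>, a p * cis (- \<theta>)] q n
              / qpoch (A / q) q n)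
           * qhyp n q (entries_except p (\<lambda>s. q powi (1 - int n) / (a p * a s))) bs q)
     \<and>
     (let bs = [a p * a r,
                q powi (1 - int n) * cis \<theta> / a t, q powi (1 - int n) * cis \<theta> / a u]
      in admissible n q bs \<longrightarrow>
         askey_wilson p n x a q =
           cis (real n * \<theta>) * qpochs [a p * a r, a t * cis (- \<theta>), a u * cis (- \<theta>)] q n
           * qhyp n q [a p * cis \<theta>, a r * cis \<theta>, q powi (1 - int n) / (a t * a u)] bs q)
     \<and>
     (let b = q powi (1 - 2 * int n) * a p * cis \<theta> / A;
          cs = entries_except p (\<lambda>s. q powi (1 - int n) * (a p * a s) / A) @ [a p * cis \<theta>]
      in \<forall>s. s ^ 2 = b \<and> qpoch (A / q) q n \<noteq> 0
           \<and> qpoch (A * cis (- \<theta>) / (q * a p)) q (2 * n) \<noteq> 0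
           \<and> admissible n q (W_lower n q b s cs) \<longrightarrow>
         askey_wilson p n x a q =
           cis (real n * \<theta>)
           * (qpoch (A / q) q (2 * n)
              * qpochs (entries_except p (\<lambda>s. a s * cis (- \<theta>)) @ [A * cis (- \<theta>) / (q * a p)]) q n
              / (qpoch (A / q) q n * qpoch (A * cis (- \<theta>) / (q * a p)) q (2 * n)))
           * W87 n q b s cs (q * cis \<theta> / a p))
     \<and>
     (let b = A * cis \<theta> / (q * a p);
          cs = entries_except p (\<lambda>s. a s * cis \<theta>) @ [q powi (int n - 1) * A]
      in \<forall>s. s ^ 2 = b \<and> qpoch (A * cis \<theta> / a p) q n \<noteq> 0
           \<and> admissible n q (W_lower n q b s cs) \<longrightarrow>
         askey_wilson p n x a q =
           cis (real n * \<theta>)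
           * (qpochs (a p * cis (- \<theta>) # entries_except p (\<lambda>s. A / (a p * a s))) q n
              / qpoch (A * cis \<theta> / a p) q n)
           * W87 n q b s cs (q * cis (- \<theta>) / a p))
     \<and>
     (let b = q powi (- int n) * a p / a r;
          cs = [q powi (1 - int n) / (a r * a t), q powi (1 - int n) / (a r * a u),
                a p * cis \<theta>, a p * cis (- \<theta>)]
      in \<forall>s. s ^ 2 = b \<and> qpoch (a r / a p) q n \<noteq> 0
           \<and> admissible n q (W_lower n q b s cs) \<longrightarrow>
         askey_wilson p n x a q =
           a p powi (- int n)
           * (qpochs [a p * a t, a p * a u, a r * cis \<theta>, a r * cis (- \<theta>)] q n
              / qpoch (a r / a p) q n)
           * W87 n q b s cs (q ^ n * (a t * a u)))
     \<and>
     (let b = q powi (- int n) * cis (2 * \<theta>);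
          cs = entries (\<lambda>s. a s * cis \<theta>)
      in \<forall>s. s ^ 2 = b \<and> qpoch (cis (- 2 * \<theta>)) q n \<noteq> 0
           \<and> admissible n q (W_lower n q b s cs) \<longrightarrow>
         askey_wilson p n x a q =
           cis (real n * \<theta>)
           * (qpochs (entries (\<lambda>s. a s * cis (- \<theta>))) q n / qpoch (cis (- 2 * \<theta>)) q n)
           * W87 n q b s cs (q powi (2 - int n) / A))"
proof -
  note idx = assms(1,2)
  define E F v where "E = cis \<theta>" and "F = cis (- \<theta>)" and "v = q powi (1 - int n)"
  interpret not_root_of_unity q
    using assms(3,4) by (rule not_root_of_unity_if_norm)
  have v: "v = q / q ^ n"
    using assms(3) by (simp add: v_def power_int_diff)
  have powers: "q powi (int n - 1) = 1 / v" "q powi (2 - 2 * int n) = v\<^sup>2" "q powi (1 - 2 * int n) = v / q ^ n"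
      "q powi (2 - int n) = q * v" "q powi (- int n) = 1 / q ^ n" "a p powi (- int n) = 1 / a p ^ n"
    using assms(3) by (simp_all add: v power_int_diff power_int_minus power2_eq_square power_int_mult
        inverse_eq_divide power_mult_distrib)
  have angles: "cis (real n * \<theta>) = E ^ n" "cis (2 * \<theta>) = E\<^sup>2" "cis (- 2 * \<theta>) = F\<^sup>2"
    by (simp_all add: E_def F_def DeMoivre)
  have index: "p \<in> {1, 2, 3, 4}" "r \<in> {1, 2, 3, 4}" "t \<in> {1, 2, 3, 4}" "u \<in> {1, 2, 3, 4}"
    using assms(1) by auto
  note except = mset_entries_except[OF idx]
  have A: "A = a p * a r * a t * a u"
  proof -
    have "A = prod_mset (mset (entries a))"
      by (simp add: assms(6) entries_def mult_ac)
    then show ?thesis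
      by (simp add: mset_entries[OF idx] mult_ac)
  qed
  have adm: "admissible n q [a p * a r, a p * a t, a p * a u]"
    using assms(8) admissible_mset[OF except] by simp
  interpret askey_wilson_parameters q n v "a p" "a r" "a t" "a u" A E F
    using adm assms(3) A index by unfold_locales
      (auto simp: v assms(5) admissible_iff_qpoch E_def F_def cis_mult)
  have first: "askey_wilson p n x a q =
       a p powi (- int n) * qpochs (entries_except p (\<lambda>s. a p * a s)) q n
       * qhyp n q [q powi (int n - 1) * A, a p * cis \<theta>, a p * cis (- \<theta>)]
           (entries_except p (\<lambda>s. a p * a s)) q"
    using cis_arccos_cos[of \<theta>]
  proof
    assume "cis (arccos (cos \<theta>)) = cis (- \<theta>) \<and> cis (- arccos (cos \<theta>)) = cis \<theta>"
    then show ?thesis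
      unfolding askey_wilson_def Let_def assms(6,7)
      by (intro arg_cong2[of _ _ _ _ "(*)"] refl qhyp_mset) simp_all
  qed (simp add: askey_wilson_def assms(6,7))
  also have "\<dots> = aw"
    unfolding aw_def powers E_def[symmetric] F_def[symmetric] qpochs_mset[OF except]
    using qhyp_mset[OF refl except] by simp
  finally have aw: "askey_wilson p n x a q = aw" .
  show ?thesis
    unfolding Let_def
  proof (intro conjI allI impI, unfold powers angles, fold E_def F_def v_def, goal_cases)
    case 1
    show ?case
      using first unfolding powers E_def F_def .
  next
    case 2
    have "q powi (- int (n choose 2)) * (- a p) powi (- int n) = 1 / (K * a p ^ n)"
      using nonzero(1) q_nonzero by (cases "even n") (simp_all add: qsign_def power_int_minus field_simps)
    then show ?case
      unfolding aw qhyp_mset[OF except refl] qpochs_simps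
      using aw_reversed_4phi3 2 by (simp add: admissible_iff_qpoch q_nonzero)
  next
    case 3
    then show ?case
      unfolding aw qpochs_simps
      using aw_sears_4phi3 by (simp add: admissible_iff_qpoch q_nonzero mult_ac)
  next
    case (4 s)
    let ?cs = "[v * (a p * a r) / A, v * (a p * a t) / A, v * (a p * a u) / A, a p * E]"
    have cs: "mset (entries_except p (\<lambda>s. v * (a p * a s) / A) @ [a p * E]) = mset ?cs"
      unfolding mset_append except by simp
    have cs': "mset (entries_except p (\<lambda>s. a s * F) @ [A * F / (q * a p)])
        = mset [a r * F, a t * F, a u * F, A * F / (q * a p)]"
      unfolding mset_append except by simp
    show ?case
      using 4 aw_W87_reversed[OF refl, of s]
      unfolding aw W87_mset[OF cs] admissible_W_lower_mset[OF cs] qpochs_mset[OF cs'] qpochs_simps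
      by (simp add: mult.assoc)
  next
    case (5 s)
    have cs: "mset (entries_except p (\<lambda>s. a s * E) @ [1 / v * A]) = mset [a r * E, a t * E, a u * E, 1 / v * A]"
      unfolding mset_append except by simp
    show ?case
      using 5 aw_W87_forward[OF refl, of s]
      unfolding aw W87_mset[OF cs] admissible_W_lower_mset[OF cs] qpochs_simps qpochs_mset[OF except]
      by (simp add: mult.assoc)
  next
    case (6 s)
    then show ?case
      using aw_W87_two_parameters[OF refl, of s] unfolding aw qpochs_simps by (simp add: mult.assoc)
  next
    case (7 s)
    note cs = mset_entries[OF idx, of "\<lambda>s. a s * E"] and cs' = mset_entries[OF idx, of "\<lambda>s. a s * F"]
    show ?case
      using 7 aw_W87_symmetric[OF refl, of s]
      unfolding aw W87_mset[OF cs] admissible_W_lower_mset[OF cs] qpochs_mset[OF cs'] qpochs_simps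
      by (simp add: mult.assoc)
  qed
qed

end
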